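(* Let $\mathcal K=(K,\mathcal F(K))$ be a field of definable characteristic zero and let $n\in\mathbf N=\mathbf N(\mathcal K)$. Put on $\mathbf N^{(n)}$ the componentwise order. Then every definable subset $A\subseteq\mathbf N^{(n)}$ has a hyperfinite basis $B\subseteq A$.
   Context: **Definable finite power sets.** "Definable" means first-order definable with parameters. Let $X,Y$ be definable sets in a structure and $\in^*\subseteq X\times Y$ a definable relation. $Y$ is a definable finite power set of $X$ with respect to $\in^*$ (written $\mathcal F(X)=Y$) if: (i) $B,C\in\mathcal F(X)$ are equal iff for all $x\in X$, $x\in^* B\iff x\in^* C$; (ii) there is $\emptyset^*\in\mathcal F(X)$ with $x\notin^*\emptyset^*$ for all $x\in X$; (iii) for each $a\in X$ there is $\{a\}^*\in\mathcal F(X)$ with $x\in^*\{a\}^*\iff x=a$; (iv) for $B,C\in\mathcal F(X)$ there is $B\cup^*C\in\mathcal F(X)$ with $x\in^* B\cup^* C\iff x\in^*B\lor x\in^*C$; (v) every definable $\mathcal U\subseteq\mathcal F(X)$ such that $\emptyset^*\in\mathcal U$ and $B\cup^*\{x\}^*\in\mathcal U$ for all $B\in\mathcal U$, $x\in X$, equals $\mathcal F(X)$. For $a\in\mathcal F(X)$ let $\operatorname{ext}(a)=\{x\in X: x\in^*a\}$. A definable set $X$ is hyperfinite if it has a definable finite power set $\mathcal F(X)$ and $X=\operatorname{ext}(a)$ for some $a\in\mathcal F(X)$. **Fields.** Consider structures $\mathcal K=(K,\mathcal F(K))$ with a field sort $K$, a second sort $\mathcal F(K)$ and a relation $\in^*$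 making $\mathcal F(K)$ a definable finite power set of $K$; definability is meant in $\mathcal K^{eq}$. Let $K_0$ be the set of $x\in K$ for which there is $F\in\mathcal F(K)$ with $x\in^*F$ and, for all $z\in^* F$, if $z\ne0$ then $z-1\in^*F$. $\mathcal K$ has definable characteristic zero if $-1\notin K_0$. In that case put $\mathbf N(\mathcal K)=K_0$, which with $+,\cdot$ is a model of Peano Arithmetic (ordered by $x\le y\iff y-x\in\mathbf N$) satisfying induction for all $\mathcal K$-definable subsets. In $\mathcal K^{eq}$ every definable set $X$ has a definable finite power set $\mathcal F(X)$, unique up to a definable bijection preserving extensions. For $n\in\mathbf N$, $(n)=\{i\in\mathbf N:i<n\}$, and $\mathbf N^{(n)}$ is the (definable) set of hyperfinite functions $(n)\to\mathbf N$ (elements of $\mathcal F((n)\times\mathbf N)$ whose extension is such a function). The componentwise order on $\mathbf N^{(n)}$ is: $\alpha\le\beta$ iff $\alpha(i)\le\beta(i)$ for all $i\in(n)$. If $(P,\le)$ is a partially ordered set and $A\subseteq P$, a basis of $A$ is a subset $B\subseteq A$ such that every element of $A$ is $\ge$ some element of $B$. *)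

theory Defs
  imports Main
begin

section \<open>Many-sorted first-order logic\<close>

text \<open>
  Formulas over sorts \<open>'s\<close> and relation symbols \<open>'r\<close>. Variables carry no sort of their own;
  the sort is given by the quantifier. The elements of all sorts live in one type \<open>'u\<close>, a
  structure being given by the domains \<open>D\<close> of the sorts and the interpretation \<open>I\<close> of the
  relation symbols. An atom applied to elements of the wrong sorts is false.
\<close>

datatype ('s, 'r) fm =
    Rel 'r "nat list"
  | Eq nat nat
  | Neg "('s, 'r) fm"
  | Conj "('s, 'r) fm" "('s, 'r) fm"
  | Ex 's nat "('s, 'r) fm"

primrec fv :: "('s, 'r) fm \<Rightarrow> nat set" where
  "fv (Rel r is) = set is"
| "fv (Eq i j) = {i, j}"
| "fv (Neg \<phi>) = fv \<phi>"
| "fv (Conj \<phi> \<psi>) = fv \<phi> \<union> fv \<psi>"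
| "fv (Ex s i \<phi>) = fv \<phi> - {i}"

primrec sat ::
  "('s \<Rightarrow> 'u set) \<Rightarrow> ('r \<Rightarrow> 'u list \<Rightarrow> bool) \<Rightarrow> (nat \<Rightarrow> 'u) \<Rightarrow> ('s, 'r) fm \<Rightarrow> bool" where
  "sat D I v (Rel r is) \<longleftrightarrow> I r (map v is)"
| "sat D I v (Eq i j) \<longleftrightarrow> v i = v j"
| "sat D I v (Neg \<phi>) \<longleftrightarrow> \<not> sat D I v \<phi>"
| "sat D I v (Conj \<phi> \<psi>) \<longleftrightarrow> sat D I v \<phi> \<and> sat D I v \<psi>"
| "sat D I v (Ex s i \<phi>) \<longleftrightarrow> (\<exists>x\<in>D s. sat D I (v(i := x)) \<phi>)"

definition tuples :: "('s \<Rightarrow> 'u set) \<Rightarrow> 's list \<Rightarrow> 'u list set" where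
  "tuples D ss = {xs. list_all2 (\<lambda>x s. x \<in> D s) xs ss}"

text \<open>
  A definable set is a set of tuples from a fixed finite product of sorts. The valuation
  \<open>(!) (xs @ ps)\<close> is only relevant below \<open>length (xs @ ps)\<close>, by the condition on \<open>fv\<close>;
  \<open>ps\<close> is the list of parameters.
\<close>

definition definable ::
  "('s \<Rightarrow> 'u set) \<Rightarrow> ('r \<Rightarrow> 'u list \<Rightarrow> bool) \<Rightarrow> 'u list set \<Rightarrow> bool" where
  "definable D I X \<longleftrightarrow>
     (\<exists>ss \<phi> ps. set ps \<subseteq> (\<Union>s. D s) \<and> fv \<phi> \<subseteq> {..<length ss + length ps} \<and>
        X = {xs \<in> tuples D ss. sat D I ((!) (xs @ ps)) \<phi>})"

section \<open>The two-sorted structure\<close>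

text \<open>
  The field sort is the type \<open>'a\<close>, the sort \<open>F(K)\<close> is the type \<open>'f\<close>, and \<open>mem x F\<close> is
  the membership relation. The language is relational: the graphs of addition and
  multiplication and the membership relation. The remaining field operations are definable
  from these without parameters.
\<close>

datatype hsort = FieldSort | FinSort
datatype hrel = AddRel | MulRel | MemRel
datatype ('a, 'f) hel = FieldEl 'a | FinEl 'f

primrec hdom :: "hsort \<Rightarrow> ('a, 'f) hel set" where
  "hdom FieldSort = range FieldEl"
| "hdom FinSort = range FinEl"

primrec hint :: "('a::field \<Rightarrow> 'f \<Rightarrow> bool) \<Rightarrow> hrel \<Rightarrow> ('a, 'f) hel list \<Rightarrow> bool" where
  "hint mem AddRel us \<longleftrightarrow> (\<exists>a b. us = [FieldEl a, FieldEl b, FieldEl (a + b)])"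
| "hint mem MulRel us \<longleftrightarrow> (\<exists>a b. us = [FieldEl a, FieldEl b, FieldEl (a * b)])"
| "hint mem MemRel us \<longleftrightarrow> (\<exists>a F. us = [FieldEl a, FinEl F] \<and> mem a F)"

section \<open>The structure with imaginaries\<close>

text \<open>
  Besides the home sorts there is, for every list \<open>ss\<close> of home sorts and every formula
  \<open>\<phi>\<close> without parameters defining an equivalence relation on the product of \<open>ss\<close>, the sort
  \<open>Quot ss \<phi>\<close> of its classes (other sorts \<open>Quot ss \<phi>\<close> are empty). The relation \<open>Proj ss \<phi>\<close>
  is the graph of the projection. Classes are tagged by their sort, so that distinct sorts are
  disjoint.
\<close>

type_synonym hfm = "(hsort, hrel) fm"

datatype esort = Home hsort | Quot "hsort list" hfm
datatype erel = HomeRel hrel | Proj "hsort list" hfm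
datatype ('a, 'f) eel = HomeEl "('a, 'f) hel" | Cls "hsort list" hfm "('a, 'f) hel list set"

definition eqv_rel ::
  "('a::field \<Rightarrow> 'f \<Rightarrow> bool) \<Rightarrow> hsort list \<Rightarrow> hfm \<Rightarrow> ('a, 'f) hel list rel" where
  "eqv_rel mem ss \<phi> =
     {(xs, ys). xs \<in> tuples hdom ss \<and> ys \<in> tuples hdom ss \<and>
        sat hdom (hint mem) ((!) (xs @ ys)) \<phi>}"

definition eqv_fm :: "('a::field \<Rightarrow> 'f \<Rightarrow> bool) \<Rightarrow> hsort list \<Rightarrow> hfm \<Rightarrow> bool" where
  "eqv_fm mem ss \<phi> \<longleftrightarrow>
     fv \<phi> \<subseteq> {..<2 * length ss} \<and> equiv (tuples hdom ss) (eqv_rel mem ss \<phi>)"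

primrec edom :: "('a::field \<Rightarrow> 'f \<Rightarrow> bool) \<Rightarrow> esort \<Rightarrow> ('a, 'f) eel set" where
  "edom mem (Home s) = HomeEl ` hdom s"
| "edom mem (Quot ss \<phi>) =
     (if eqv_fm mem ss \<phi> then Cls ss \<phi> ` (tuples hdom ss // eqv_rel mem ss \<phi>) else {})"

primrec eint :: "('a::field \<Rightarrow> 'f \<Rightarrow> bool) \<Rightarrow> erel \<Rightarrow> ('a, 'f) eel list \<Rightarrow> bool" where
  "eint mem (HomeRel r) us \<longleftrightarrow> (\<exists>xs. us = map HomeEl xs \<and> hint mem r xs)"
| "eint mem (Proj ss \<phi>) us \<longleftrightarrow>
     eqv_fm mem ss \<phi> \<and>
     (\<exists>xs\<in>tuples hdom ss. us = map HomeEl xs @ [Cls ss \<phi> (eqv_rel mem ss \<phi> `` {xs})])"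

abbreviation eq_definable :: "('a::field \<Rightarrow> 'f \<Rightarrow> bool) \<Rightarrow> ('a, 'f) eel list set \<Rightarrow> bool" where
  "eq_definable mem \<equiv> definable (edom mem) (eint mem)"

section \<open>Definable finite power sets\<close>

definition ext :: "('u list \<times> 'u list) set \<Rightarrow> 'u list \<Rightarrow> 'u list set" where
  "ext R B = {x. (x, B) \<in> R}"

text \<open>
  \<open>Y\<close> is a definable finite power set of \<open>X\<close> with respect to the membership relation \<open>R\<close>.
  A relation between tuples is definable if the set of concatenated tuples is; the
  concatenation determines the pair, because all tuples in \<open>X\<close> have the same length.
  In the last clause, \<open>C\<close> with \<open>ext R C = insert x (ext R B)\<close> is the union of \<open>B\<close> and the
  singleton of \<open>x\<close>.
\<close>

definition finite_power_set ::
  "('a::field \<Rightarrow> 'f \<Rightarrow> bool) \<Rightarrow> ('a, 'f) eel list set \<Rightarrow> ('a, 'f) eel list set \<Rightarrow>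
   (('a, 'f) eel list \<times> ('a, 'f) eel list) set \<Rightarrow> bool" where
  "finite_power_set mem X Y R \<longleftrightarrow>
     eq_definable mem X \<and> eq_definable mem Y \<and>
     R \<subseteq> X \<times> Y \<and> eq_definable mem {x @ B | x B. (x, B) \<in> R} \<and>
     (\<forall>B\<in>Y. \<forall>C\<in>Y. B = C \<longleftrightarrow> ext R B = ext R C) \<and>
     (\<exists>E\<in>Y. ext R E = {}) \<and>
     (\<forall>a\<in>X. \<exists>S\<in>Y. ext R S = {a}) \<and>
     (\<forall>B\<in>Y. \<forall>C\<in>Y. \<exists>U\<in>Y. ext R U = ext R B \<union> ext R C) \<and>
     (\<forall>\<U>. \<U> \<subseteq> Y \<and> eq_definable mem \<U> \<and>
        (\<forall>E\<in>Y. ext R E = {} \<longrightarrow> E \<in> \<U>) \<and>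
        (\<forall>B\<in>\<U>. \<forall>x\<in>X. \<forall>C\<in>Y. ext R C = insert x (ext R B) \<longrightarrow> C \<in> \<U>)
        \<longrightarrow> \<U> = Y)"

definition hyperfinite :: "('a::field \<Rightarrow> 'f \<Rightarrow> bool) \<Rightarrow> ('a, 'f) eel list set \<Rightarrow> bool" where
  "hyperfinite mem X \<longleftrightarrow> (\<exists>Y R. finite_power_set mem X Y R \<and> (\<exists>a\<in>Y. X = ext R a))"

section \<open>Fields with a definable finite power set\<close>

abbreviation fld :: "'a \<Rightarrow> ('a, 'f) eel" where
  "fld a \<equiv> HomeEl (FieldEl a)"

abbreviation fin :: "'f \<Rightarrow> ('a, 'f) eel" where
  "fin F \<equiv> HomeEl (FinEl F)"

definition finite_power_field :: "('a::field \<Rightarrow> 'f \<Rightarrow> bool) \<Rightarrow> bool" where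
  "finite_power_field mem \<longleftrightarrow>
     finite_power_set mem {[fld a] | a. True} {[fin F] | F. True} {([fld a], [fin F]) | a F. mem a F}"

text \<open>The set \<open>K\<^sub>0\<close>, which is the set of natural numbers in definable characteristic zero.\<close>

definition nats :: "('a::field \<Rightarrow> 'f \<Rightarrow> bool) \<Rightarrow> 'a set" where
  "nats mem = {x. \<exists>F. mem x F \<and> (\<forall>z. mem z F \<longrightarrow> z \<noteq> 0 \<longrightarrow> mem (z - 1) F)}"

definition definable_char_zero :: "('a::field \<Rightarrow> 'f \<Rightarrow> bool) \<Rightarrow> bool" where
  "definable_char_zero mem \<longleftrightarrow> - 1 \<notin> nats mem"

definition nats_le :: "('a::field \<Rightarrow> 'f \<Rightarrow> bool) \<Rightarrow> 'a \<Rightarrow> 'a \<Rightarrow> bool" where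
  "nats_le mem x y \<longleftrightarrow> y - x \<in> nats mem"

definition seg :: "('a::field \<Rightarrow> 'f \<Rightarrow> bool) \<Rightarrow> 'a \<Rightarrow> 'a set" where
  "seg mem n = {i \<in> nats mem. nats_le mem i n \<and> i \<noteq> n}"

definition seg_times_nats :: "('a::field \<Rightarrow> 'f \<Rightarrow> bool) \<Rightarrow> 'a \<Rightarrow> ('a, 'f) eel list set" where
  "seg_times_nats mem n = {[fld i, fld j] | i j. i \<in> seg mem n \<and> j \<in> nats mem}"

text \<open>
  Hyperfinite functions from \<open>seg mem n\<close> to \<open>nats mem\<close>, as elements of a definable finite power
  set \<open>P\<close> of \<open>seg_times_nats mem n\<close> with membership relation \<open>R\<close>.
\<close>

definition hyp_funs ::
  "('a::field \<Rightarrow> 'f \<Rightarrow> bool) \<Rightarrow> 'a \<Rightarrow> ('a, 'f) eel list set \<Rightarrow>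
   (('a, 'f) eel list \<times> ('a, 'f) eel list) set \<Rightarrow> ('a, 'f) eel list set" where
  "hyp_funs mem n P R =
     {\<alpha> \<in> P. ext R \<alpha> \<subseteq> seg_times_nats mem n \<and>
        (\<forall>i\<in>seg mem n. \<exists>!j. j \<in> nats mem \<and> [fld i, fld j] \<in> ext R \<alpha>)}"

definition hyp_app ::
  "('a::field \<Rightarrow> 'f \<Rightarrow> bool) \<Rightarrow> (('a, 'f) eel list \<times> ('a, 'f) eel list) set \<Rightarrow>
   ('a, 'f) eel list \<Rightarrow> 'a \<Rightarrow> 'a" where
  "hyp_app mem R \<alpha> i = (THE j. j \<in> nats mem \<and> [fld i, fld j] \<in> ext R \<alpha>)"

definition hyp_funs_le ::
  "('a::field \<Rightarrow> 'f \<Rightarrow> bool) \<Rightarrow> 'a \<Rightarrow> (('a, 'f) eel list \<times> ('a, 'f) eel list) set \<Rightarrow>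
   ('a, 'f) eel list \<Rightarrow> ('a, 'f) eel list \<Rightarrow> bool" where
  "hyp_funs_le mem n R \<alpha> \<beta> \<longleftrightarrow>
     (\<forall>i\<in>seg mem n. nats_le mem (hyp_app mem R \<alpha> i) (hyp_app mem R \<beta> i))"

definition is_basis :: "('b \<Rightarrow> 'b \<Rightarrow> bool) \<Rightarrow> 'b set \<Rightarrow> 'b set \<Rightarrow> bool" where
  "is_basis le A B \<longleftrightarrow> B \<subseteq> A \<and> (\<forall>a\<in>A. \<exists>b\<in>B. le b a)"

end

theory Submission
  imports Defs
begin

text \<open>
  The theorem is Dickson's lemma inside a field of definable characteristic zero. The usual proof
  is by induction on the number of coordinates, and the induction hypothesis ranges over all
  definable sets. Here \<open>n\<close> may be nonstandard, so the induction has to be carried out inside the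
  structure and its statement must be a single first-order formula. Three observations make this
  possible.

  The first is that a hyperfinite basis can be replaced by a bound. It is enough to find
  \<open>u\<close> such that the elements of \<open>A\<close> with all values at most \<open>u\<close> form a basis, because a definable
  set of functions with values at most \<open>u\<close> is hyperfinite. Thus no quantifier over hyperfinite
  sets of functions occurs in the induction.

  The second is that the slices and projections of \<open>A\<close> met in the classical proof form one
  definable family. Prescribe values at some coordinates \<open>j \<ge> i\<close>, forget the other coordinates
  from \<open>i\<close> on, and compare functions only below \<open>i\<close>. The prescribed values are a
  hyperfinite set of codes of pairs, hence an element \<open>F\<close> of the second sort. The
  statement proved by induction on \<open>i\<close> says that, for every \<open>F\<close> that prescribes nothing below \<open>i\<close>,
  some \<open>u\<close> bounds a basis of the corresponding member of the family
  (\<open>bounded_basis_constrained\<close>). In the step, forget coordinate \<open>i\<close> to get a bound \<open>u\<^sub>0\<close>. A function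
  whose value at \<open>i\<close> is at least \<open>u\<^sub>0\<close> lies above a function bounded by \<open>u\<^sub>0\<close>, also at \<open>i\<close>. For
  the values \<open>t \<le> u\<^sub>0\<close>, prescribe the value \<open>t\<close> at \<open>i\<close> and collect the resulting bounds by
  induction on \<open>u\<^sub>0\<close> (\<open>bounded_basis_step\<close>).

  The third is that the functions bounded by \<open>u\<close> can be enumerated by numbers: by induction
  on \<open>i\<close>, one element of the second sort lists all their restrictions below \<open>i\<close> with indices
  from an initial segment (\<open>enumeration\<close>). The least index is a definable injection into the field
  with hyperfinite image, and pulling back the finite power set of the field along it gives a
  definable finite power set (\<open>hyperfinite_if_coded\<close>).

  Both inductions, and the arithmetic of the natural numbers that they use, rest on the
  principle of induction over the finite power set of the field, which applies to definable sets
  only. Most of the beginning is therefore a calculus that reads off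
  definability from the shape of a predicate.
\<close>

section \<open>Definable predicates on valuations\<close>

text \<open>
  Renaming of variables. The bound variable is replaced by a fresh one, so that renaming is
  capture-free for every \<open>f\<close>, injective or not.
\<close>

primrec rename :: "(nat \<Rightarrow> nat) \<Rightarrow> ('s, 'r) fm \<Rightarrow> ('s, 'r) fm" where
  "rename f (Rel r is) = Rel r (map f is)"
| "rename f (Eq i j) = Eq (f i) (f j)"
| "rename f (Neg \<phi>) = Neg (rename f \<phi>)"
| "rename f (Conj \<phi> \<psi>) = Conj (rename f \<phi>) (rename f \<psi>)"
| "rename f (Ex s i \<phi>) =
     (let j = Suc (Max (insert 0 (f ` fv \<phi>))) in Ex s j (rename (f(i := j)) \<phi>))"

lemma finite_fv [simp]: "finite (fv \<phi>)"
  by (induction \<phi>) auto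

lemma sat_cong: "(\<And>i. i \<in> fv \<phi> \<Longrightarrow> v i = w i) \<Longrightarrow> sat D I v \<phi> \<longleftrightarrow> sat D I w \<phi>"
proof (induction \<phi> arbitrary: v w)
  case (Rel r js)
  then have "map v js = map w js" by simp
  then show ?case by (metis sat.simps(1))
next
  case (Ex s i \<phi>)
  have "sat D I (v(i := x)) \<phi> \<longleftrightarrow> sat D I (w(i := x)) \<phi>" for x
    by (rule Ex.IH) (use Ex.prems in auto)
  then show ?case by simp
next
  case (Conj \<phi> \<psi>)
  then show ?case by (metis UnCI fv.simps(4) sat.simps(4))
next
  case (Neg \<phi>)
  then show ?case by (metis fv.simps(3) sat.simps(3))
qed auto

lemma fv_rename: "fv (rename f \<phi>) \<subseteq> f ` fv \<phi>"
proof (induction \<phi> arbitrary: f)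
  case (Ex s i \<phi>)
  define j where "j = Suc (Max (insert 0 (f ` fv \<phi>)))"
  have "x \<in> f ` (fv \<phi> - {i})" if "x \<in> fv (rename (f(i := j)) \<phi>)" "x \<noteq> j" for x
  proof -
    have "x \<in> (f(i := j)) ` fv \<phi>" using Ex.IH that(1) by (rule subsetD)
    then obtain k where "x = (f(i := j)) k" "k \<in> fv \<phi>" by (rule imageE)
    then show ?thesis using that(2) by (cases "k = i") auto
  qed
  then show ?case by (auto simp: j_def[symmetric] Let_def)
next
  case (Conj \<phi> \<psi>)
  then show ?case by (auto simp: image_Un le_supI1 le_supI2)
qed auto

lemma sat_rename: "sat D I v (rename f \<phi>) \<longleftrightarrow> sat D I (\<lambda>i. v (f i)) \<phi>"
proof (induction \<phi> arbitrary: v f)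
  case (Rel r js)
  then show ?case by (simp add: comp_def)
next
  case (Ex s i \<phi>)
  define j where "j = Suc (Max (insert 0 (f ` fv \<phi>)))"
  have fresh: "f k \<noteq> j" if "k \<in> fv \<phi>" for k
  proof -
    have "f k \<le> Max (insert 0 (f ` fv \<phi>))" using that by (intro Max_ge) auto
    then show ?thesis unfolding j_def by simp
  qed
  have "sat D I (\<lambda>k. (v(j := x)) ((f(i := j)) k)) \<phi> \<longleftrightarrow> sat D I ((\<lambda>k. v (f k))(i := x)) \<phi>" for x
    by (rule sat_cong) (auto simp: fresh)
  then show ?case by (simp add: Ex.IH j_def[symmetric])
qed auto

text \<open>
  The terms of a relational language with parameters.
\<close>

definition atomic_term :: "('s \<Rightarrow> 'u set) \<Rightarrow> ((nat \<Rightarrow> 'u) \<Rightarrow> 'u) \<Rightarrow> bool" where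
  "atomic_term D t \<longleftrightarrow> (\<exists>i. t = (\<lambda>v. v i)) \<or> (\<exists>s. \<exists>c\<in>D s. t = (\<lambda>_. c))"

lemma atomic_var [simp, intro]: "atomic_term D (\<lambda>v. v i)"
  and atomic_const: "c \<in> D s \<Longrightarrow> atomic_term D (\<lambda>_. c)"
  by (auto simp: atomic_term_def)

lemma atomic_subst:
  assumes "atomic_term D t" "\<And>i. atomic_term D (f i)"
  shows "atomic_term D (\<lambda>v. t (\<lambda>i. f i v))"
  using assms(1)[unfolded atomic_term_def]
proof
  assume "\<exists>i. t = (\<lambda>v. v i)"
  then show ?thesis using assms(2) by auto
next
  assume "\<exists>s. \<exists>c\<in>D s. t = (\<lambda>_. c)"
  then show ?thesis by (auto intro: atomic_const)
qed

text \<open>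
  Definability with parameters, for predicates on valuations. The variables of \<open>\<phi>\<close> are filled in by
  arbitrary atomic terms \<open>t i\<close>. Parameters and variables are thus treated alike, and closure under
  substitution of atomic terms is immediate.
  
  Variables are de Bruijn indices: under a quantifier, the new variable is \<open>v 0\<close> and an old
  variable \<open>v i\<close> becomes \<open>v (Suc i)\<close>. The closure rules below are stated so that backward
  resolution with them does this bookkeeping by unification.
\<close>

definition definable_pred ::
  "('s \<Rightarrow> 'u set) \<Rightarrow> ('r \<Rightarrow> 'u list \<Rightarrow> bool) \<Rightarrow> ((nat \<Rightarrow> 'u) \<Rightarrow> bool) \<Rightarrow> bool" where
  "definable_pred D I Q \<longleftrightarrow>
     (\<exists>\<phi> t. (\<forall>i. atomic_term D (t i)) \<and> (\<forall>v. Q v \<longleftrightarrow> sat D I (\<lambda>i. t i v) \<phi>))"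

lemma definable_predI:
  "\<lbrakk>\<And>i. atomic_term D (t i); \<And>v. Q v \<longleftrightarrow> sat D I (\<lambda>i. t i v) \<phi>\<rbrakk> \<Longrightarrow> definable_pred D I Q"
  unfolding definable_pred_def by blast

text \<open>
  Substitution of atomic terms, which covers weakening, exchange and instantiation by parameters.
\<close>

lemma definable_pred_subst:
  assumes "definable_pred D I Q" "\<And>i. atomic_term D (f i)"
  shows "definable_pred D I (\<lambda>v. Q (\<lambda>i. f i v))"
proof -
  obtain \<phi> t where "\<And>i. atomic_term D (t i)" "\<And>v. Q v \<longleftrightarrow> sat D I (\<lambda>i. t i v) \<phi>"
    using assms(1) unfolding definable_pred_def by blast
  then show ?thesis
    by (intro definable_predI[where t = "\<lambda>i v. t i (\<lambda>j. f j v)" and \<phi> = \<phi>])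
       (use assms(2) in \<open>auto intro: atomic_subst\<close>)
qed

lemma definable_pred_eq:
  assumes "atomic_term D s" "atomic_term D t"
  shows "definable_pred D I (\<lambda>v. s v = t v)"
  by (rule definable_predI[where t = "\<lambda>i. if i = 0 then s else t" and \<phi> = "Eq 0 1"])
     (use assms in auto)

lemma definable_pred_True: "definable_pred D I (\<lambda>v. True)"
  by (rule definable_predI[where t = "\<lambda>i v. v i" and \<phi> = "Eq 0 0"]) auto

lemma definable_pred_rel: "definable_pred D I (\<lambda>v. I r (map v is))"
  by (rule definable_predI[where t = "\<lambda>i v. v i" and \<phi> = "Rel r is"]) auto

lemma definable_pred_not:
  assumes "definable_pred D I Q"
  shows "definable_pred D I (\<lambda>v. \<not> Q v)"
proof -
  obtain \<phi> t where "\<And>i. atomic_term D (t i)" "\<And>v. Q v \<longleftrightarrow> sat D I (\<lambda>i. t i v) \<phi>"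
    using assms(1) unfolding definable_pred_def by blast
  then show ?thesis by (intro definable_predI[where t = t and \<phi> = "Neg \<phi>"]) auto
qed

lemma definable_pred_conj:
  assumes "definable_pred D I Q" "definable_pred D I Q'"
  shows "definable_pred D I (\<lambda>v. Q v \<and> Q' v)"
proof -
  obtain \<phi> t where *: "\<And>i. atomic_term D (t i)" "\<And>v. Q v \<longleftrightarrow> sat D I (\<lambda>i. t i v) \<phi>"
    using assms(1) unfolding definable_pred_def by blast
  obtain \<phi>' t' where **: "\<And>i. atomic_term D (t' i)" "\<And>v. Q' v \<longleftrightarrow> sat D I (\<lambda>i. t' i v) \<phi>'"
    using assms(2) unfolding definable_pred_def by blast
  show ?thesis
    \<comment> \<open>Even variables serve the first formula, odd variables the second.\<close>
    by (rule definable_predI[where t = "\<lambda>i. if even i then t (i div 2) else t' (i div 2)"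
            and \<phi> = "Conj (rename (\<lambda>i. 2 * i) \<phi>) (rename (\<lambda>i. Suc (2 * i)) \<phi>')"])
       (simp_all add: * ** sat_rename)
qed

text \<open>
  Variable \<open>0\<close> of the new formula is the one to be bound. A variable of \<open>\<phi>\<close> is renamed to \<open>0\<close> if it
  was filled in by \<open>v 0\<close>, and otherwise moved out of the way.
\<close>

lemma definable_pred_ex:
  assumes "definable_pred D I (\<lambda>v. Q (\<lambda>i. v (Suc i)) (v 0))"
  shows "definable_pred D I (\<lambda>v. \<exists>x\<in>D s. Q v x)"
proof -
  obtain \<phi> t where t: "\<And>i. atomic_term D (t i)"
    and sat: "\<And>v. Q (\<lambda>i. v (Suc i)) (v 0) \<longleftrightarrow> sat D I (\<lambda>i. t i v) \<phi>"
    using assms unfolding definable_pred_def by blast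
  define f where "f = (\<lambda>i. if t i = (\<lambda>v. v 0) then 0 else Suc i)"
  define t' where "t' = (\<lambda>k. case k of 0 \<Rightarrow> (\<lambda>v. v 0) | Suc i \<Rightarrow>
     if t i = (\<lambda>v. v 0) then (\<lambda>v. v 0) else (\<lambda>v. t i (case_nat undefined v)))"
  \<comment> \<open>An atomic term other than \<open>v 0\<close> does not see the new entry of the valuation.\<close>
  have shift: "atomic_term D (\<lambda>v. t i (case_nat x v))
       \<and> (\<forall>v. t i (case_nat x v) = t i (case_nat y v))" if "t i \<noteq> (\<lambda>v. v 0)" for i x y
    using t[of i, unfolded atomic_term_def]
  proof
    assume "\<exists>j. t i = (\<lambda>v. v j)"
    then obtain j where j: "t i = (\<lambda>v. v j)" ..
    with that obtain k where "j = Suc k" by (cases j) auto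
    with j show ?thesis by simp
  next
    assume "\<exists>s. \<exists>c\<in>D s. t i = (\<lambda>_. c)"
    then show ?thesis by (auto intro: atomic_const)
  qed
  have "atomic_term D (t' k)" for k
    using shift by (auto simp: t'_def split: nat.split)
  moreover have "(\<exists>x\<in>D s. Q v x) \<longleftrightarrow> sat D I (\<lambda>k. t' k v) (Ex s 0 (rename f \<phi>))" for v
  proof -
    have "((\<lambda>k. t' k v)(0 := x)) (f i) = t i (case_nat x v)" for x i
      using shift[of i x undefined] by (simp add: f_def t'_def)
    then have "sat D I ((\<lambda>k. t' k v)(0 := x)) (rename f \<phi>) \<longleftrightarrow> Q v x" for x
      using sat[of "case_nat x v"] by (simp add: sat_rename)
    then show ?thesis by simp
  qed
  ultimately show ?thesis by (rule definable_predI)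
qed

lemma definable_pred_disj:
  "\<lbrakk>definable_pred D I Q; definable_pred D I Q'\<rbrakk> \<Longrightarrow> definable_pred D I (\<lambda>v. Q v \<or> Q' v)"
  using definable_pred_not[OF definable_pred_conj[OF definable_pred_not definable_pred_not]]
  by (simp add: de_Morgan_conj)

lemma definable_pred_imp:
  "\<lbrakk>definable_pred D I Q; definable_pred D I Q'\<rbrakk> \<Longrightarrow> definable_pred D I (\<lambda>v. Q v \<longrightarrow> Q' v)"
  using definable_pred_not[OF definable_pred_conj[OF _ definable_pred_not]] by simp

lemma definable_pred_iff:
  "\<lbrakk>definable_pred D I Q; definable_pred D I Q'\<rbrakk> \<Longrightarrow> definable_pred D I (\<lambda>v. Q v \<longleftrightarrow> Q' v)"
  unfolding iff_conv_conj_imp by (intro definable_pred_conj definable_pred_imp)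

lemma definable_pred_ball_finite:
  assumes "finite J" "\<And>i. i \<in> J \<Longrightarrow> definable_pred D I (Q i)"
  shows "definable_pred D I (\<lambda>v. \<forall>i\<in>J. Q i v)"
  using assms
proof (induction J)
  case empty
  then show ?case by (simp add: definable_pred_True)
next
  case (insert j J)
  then show ?case by (simp add: definable_pred_conj)
qed

lemma tuples_Nil [simp]: "tuples D [] = {[]}"
  by (simp add: tuples_def)

lemma tuples_Cons: "tuples D (s # ss) = {x # xs | x xs. x \<in> D s \<and> xs \<in> tuples D ss}"
  by (auto simp: tuples_def list_all2_Cons2)

lemma in_tuples_iff: "xs \<in> tuples D ss \<longleftrightarrow> length xs = length ss \<and> (\<forall>i<length ss. xs ! i \<in> D (ss ! i))"
  by (auto simp: tuples_def list_all2_conv_all_nth)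

text \<open>
  A quantifier over tuples is a block of quantifiers over elements: the first \<open>length ss\<close> variables
  are the entries of the tuple.
\<close>

lemma definable_pred_ex_tuple:
  assumes "definable_pred D I (\<lambda>v. Q (\<lambda>i. v (length ss + i)) (map v [0..<length ss]))"
  shows "definable_pred D I (\<lambda>v. \<exists>xs\<in>tuples D ss. Q v xs)"
  using assms
proof (induction ss arbitrary: Q)
  case Nil
  then show ?case by simp
next
  case (Cons s ss)
  let ?m = "length ss"
  \<comment> \<open>The head of the tuple is quantified first, so it ends up behind the entries of the tail.\<close>
  let ?f = "\<lambda>i v. v (if i = 0 then ?m else if i \<le> ?m then i - 1 else i)"
  have 1: "map (\<lambda>i. ?f i v) [0..<length (s # ss)] = v ?m # map v [0..<?m]" for v :: "nat \<Rightarrow> 'b"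
    by (rule nth_equalityI) (auto simp: nth_Cons split: nat.split simp del: upt_Suc)
  have "definable_pred D I
      (\<lambda>v. Q (\<lambda>i. ?f (length (s # ss) + i) v) (map (\<lambda>i. ?f i v) [0..<length (s # ss)]))"
    by (rule definable_pred_subst[OF Cons.prems, where f = ?f]) auto
  then have "definable_pred D I (\<lambda>v. Q (\<lambda>i. v (?m + Suc i)) (v ?m # map v [0..<?m]))"
    unfolding 1 by simp
  then have "definable_pred D I (\<lambda>v. \<exists>xs\<in>tuples D ss. Q (\<lambda>i. v (Suc i)) (v 0 # xs))"
    using Cons.IH[of "\<lambda>v xs. Q (\<lambda>i. v (Suc i)) (v 0 # xs)"] by simp
  then have "definable_pred D I (\<lambda>v. \<exists>x\<in>D s. \<exists>xs\<in>tuples D ss. Q v (x # xs))"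
    by (rule definable_pred_ex)
  moreover have "(\<exists>x\<in>D s. \<exists>xs\<in>tuples D ss. Q v (x # xs)) \<longleftrightarrow> (\<exists>xs\<in>tuples D (s # ss). Q v xs)" for v
    unfolding tuples_Cons by blast
  ultimately show ?case by simp
qed

lemma definable_pred_in_sort:
  assumes "atomic_term D t"
  shows "definable_pred D I (\<lambda>v. t v \<in> D s)"
proof -
  have "definable_pred D I (\<lambda>v. \<exists>x\<in>D s. x = t v)"
    using assms by (intro definable_pred_ex definable_pred_eq) (auto intro: atomic_subst)
  then show ?thesis by simp
qed

text \<open>
  Tuples of atomic terms, for the places where an element of a definable set is used as a whole.
\<close>

definition atomic_tuple :: "('s \<Rightarrow> 'u set) \<Rightarrow> ((nat \<Rightarrow> 'u) \<Rightarrow> 'u list) \<Rightarrow> bool" where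
  "atomic_tuple D t \<longleftrightarrow> (\<exists>ts. (\<forall>f\<in>set ts. atomic_term D f) \<and> t = (\<lambda>v. map (\<lambda>f. f v) ts))"

lemma atomic_tuple_Nil: "atomic_tuple D (\<lambda>v. [])"
  unfolding atomic_tuple_def by (rule exI[of _ "[]"]) simp

lemma atomic_tuple_Cons:
  assumes "atomic_term D t" "atomic_tuple D u"
  shows "atomic_tuple D (\<lambda>v. t v # u v)"
proof -
  obtain ts where "\<forall>f\<in>set ts. atomic_term D f" "u = (\<lambda>v. map (\<lambda>f. f v) ts)"
    using assms(2) unfolding atomic_tuple_def by blast
  then show ?thesis
    using assms(1) unfolding atomic_tuple_def by (intro exI[of _ "t # ts"]) simp
qed

lemma atomic_tuple_map: "atomic_tuple D (\<lambda>v. map (\<lambda>i. v (g i)) js)"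
  unfolding atomic_tuple_def
  by (rule exI[of _ "map (\<lambda>i v. v (g i)) js"]) (auto simp: comp_def)

lemma atomic_tuple_subst:
  assumes "atomic_tuple D t" "\<And>i. atomic_term D (f i)"
  shows "atomic_tuple D (\<lambda>v. t (\<lambda>i. f i v))"
proof -
  obtain ts where "\<forall>f\<in>set ts. atomic_term D f" "t = (\<lambda>v. map (\<lambda>f. f v) ts)"
    using assms(1) unfolding atomic_tuple_def by blast
  then show ?thesis
    using assms(2) unfolding atomic_tuple_def
    by (intro exI[of _ "map (\<lambda>g v. g (\<lambda>i. f i v)) ts"]) (auto simp: comp_def intro: atomic_subst)
qed

lemma definable_pred_in_definable:
  assumes X: "definable D I X" and t: "atomic_tuple D t"
  shows "definable_pred D I (\<lambda>v. t v \<in> X)"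
proof -
  obtain ss \<phi> ps where ps: "set ps \<subseteq> (\<Union>s. D s)" and fv: "fv \<phi> \<subseteq> {..<length ss + length ps}"
    and X: "X = {xs \<in> tuples D ss. sat D I ((!) (xs @ ps)) \<phi>}"
    using X unfolding definable_def by blast
  obtain ts where ts: "\<And>f. f \<in> set ts \<Longrightarrow> atomic_term D f" and t: "t = (\<lambda>v. map (\<lambda>f. f v) ts)"
    using t unfolding atomic_tuple_def by blast
  show ?thesis
  proof (cases "length ts = length ss")
    case False
    then have "t v \<notin> X" for v by (auto simp: t X in_tuples_iff)
    then show ?thesis using definable_pred_not[OF definable_pred_True, of D I] by simp
  next
    case True
    define u where "u = (\<lambda>i. if i < length ss then ts ! i
        else if i < length ss + length ps then (\<lambda>v. ps ! (i - length ss)) else (\<lambda>v. v i))"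
    have const: "atomic_term D (\<lambda>v. ps ! j)" if "j < length ps" for j
    proof -
      have "ps ! j \<in> (\<Union>s. D s)" using ps that nth_mem by blast
      then show ?thesis by (auto intro: atomic_const)
    qed
    have "sat D I ((!) (t v @ ps)) \<phi> \<longleftrightarrow> sat D I (\<lambda>i. u i v) \<phi>" for v
      by (rule sat_cong) (use fv True in \<open>auto simp: u_def t nth_append\<close>)
    moreover have "atomic_term D (u i)" for i
      using ts True const by (auto simp: u_def)
    ultimately have "definable_pred D I (\<lambda>v. sat D I ((!) (t v @ ps)) \<phi>)"
      by (intro definable_predI[where t = u])
    moreover have "definable_pred D I (\<lambda>v. \<forall>i\<in>{..<length ss}. (ts ! i) v \<in> D (ss ! i))"
      using ts True by (intro definable_pred_ball_finite definable_pred_in_sort) auto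
    ultimately have "definable_pred D I (\<lambda>v. (\<forall>i\<in>{..<length ss}. (ts ! i) v \<in> D (ss ! i)) \<and>
        sat D I ((!) (t v @ ps)) \<phi>)"
      by (intro definable_pred_conj)
    moreover have "t v \<in> X \<longleftrightarrow> (\<forall>i\<in>{..<length ss}. (ts ! i) v \<in> D (ss ! i)) \<and>
        sat D I ((!) (t v @ ps)) \<phi>" for v
      using True by (auto simp: X in_tuples_iff t)
    ultimately show ?thesis by simp
  qed
qed

text \<open>
  The return from valuations to sets of tuples. A valuation is total, so it is continued by the
  arbitrary element \<open>c\<close> beyond the tuple.
\<close>

lemma definable_tuples_pred:
  assumes Q: "definable_pred D I Q" and c: "c \<in> D s"
  shows "definable D I {xs \<in> tuples D ss. Q (\<lambda>i. if i < length ss then xs ! i else c)}"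
proof -
  obtain \<phi> t where t: "\<And>i. atomic_term D (t i)" and sat: "\<And>v. Q v \<longleftrightarrow> sat D I (\<lambda>i. t i v) \<phi>"
    using Q unfolding definable_pred_def by blast
  let ?m = "length ss"
  define N where "N = Suc (Max (insert 0 (fv \<phi>)))"
  have N: "i < N" if "i \<in> fv \<phi>" for i
    using that Max_ge[of "insert 0 (fv \<phi>)" i] unfolding N_def by (simp add: le_imp_less_Suc)
  define ps where "ps = map (\<lambda>i. t i (\<lambda>_. c)) [0..<N]"
  \<comment> \<open>Variables from \<open>?m\<close> on have the value \<open>c\<close>, like parameters.\<close>
  have "\<exists>k<?m + N. \<forall>xs. length xs = ?m \<longrightarrow>
      (xs @ ps) ! k = t i (\<lambda>i. if i < ?m then xs ! i else c)" if i: "i < N" for i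
    using t[of i, unfolded atomic_term_def]
  proof
    assume "\<exists>j. t i = (\<lambda>v. v j)"
    then obtain j where j: "t i = (\<lambda>v. v j)" ..
    show ?thesis
      by (rule exI[of _ "if j < ?m then j else ?m + i"]) (use i in \<open>simp add: j ps_def nth_append\<close>)
  next
    assume "\<exists>s. \<exists>c\<in>D s. t i = (\<lambda>_. c)"
    then show ?thesis
      by (intro exI[of _ "?m + i"]) (use i in \<open>auto simp: ps_def nth_append\<close>)
  qed
  then obtain f where f: "f i < ?m + N"
    and val: "length xs = ?m \<Longrightarrow> (xs @ ps) ! f i = t i (\<lambda>i. if i < ?m then xs ! i else c)"
    if "i < N" for i xs
    by metis
  have params: "set ps \<subseteq> (\<Union>s. D s)"
  proof -
    have "t i (\<lambda>_. c) \<in> (\<Union>s. D s)" for i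
      using t[of i] c unfolding atomic_term_def by auto
    then show ?thesis by (auto simp: ps_def)
  qed
  have sat': "sat D I ((!) (xs @ ps)) (rename f \<phi>) \<longleftrightarrow>
      Q (\<lambda>i. if i < ?m then xs ! i else c)" if "xs \<in> tuples D ss" for xs
    unfolding sat_rename sat
    by (rule sat_cong) (use that N val in \<open>simp add: in_tuples_iff\<close>)
  have "length ps = N" by (simp add: ps_def)
  then have "fv (rename f \<phi>) \<subseteq> {..<?m + length ps}"
    using fv_rename[of f \<phi>] N f by auto
  moreover have "{xs \<in> tuples D ss. Q (\<lambda>i. if i < ?m then xs ! i else c)} =
      {xs \<in> tuples D ss. sat D I ((!) (xs @ ps)) (rename f \<phi>)}"
    using sat' by blast
  ultimately show ?thesis using params unfolding definable_def by blast
qed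

section \<open>Definable terms\<close>

text \<open>
  A type \<open>'b\<close> that is in bijection with a sort via \<open>h\<close> can be used as if it were the sort. For a
  map \<open>t\<close> from valuations to such a type, definability means that the graph is definable, the value
  being variable \<open>0\<close>. Since the language is relational, this is how compound terms enter.
\<close>

definition definable_term ::
  "('s \<Rightarrow> 'u set) \<Rightarrow> ('r \<Rightarrow> 'u list \<Rightarrow> bool) \<Rightarrow> ('b \<Rightarrow> 'u) \<Rightarrow> ((nat \<Rightarrow> 'u) \<Rightarrow> 'b) \<Rightarrow> bool" where
  "definable_term D I h t \<longleftrightarrow> definable_pred D I (\<lambda>v. v 0 = h (t (\<lambda>i. v (Suc i))))"

lemma definable_term_shift:
  assumes "definable_term D I h t"
  shows "definable_term D I h (\<lambda>v. t (\<lambda>i. v (Suc i)))"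
proof -
  have "definable_pred D I (\<lambda>v. (\<lambda>i. v (case_nat 0 (\<lambda>j. Suc (Suc j)) i)) 0 =
      h (t (\<lambda>i. (\<lambda>i. v (case_nat 0 (\<lambda>j. Suc (Suc j)) i)) (Suc i))))"
    by (rule definable_pred_subst[OF assms[unfolded definable_term_def],
          where f = "\<lambda>i v. v (case_nat 0 (\<lambda>j. Suc (Suc j)) i)"])
       (rule atomic_var)
  then show ?thesis by (simp add: definable_term_def)
qed

text \<open>
  A definable term may be put in the place of a variable: name its value by an existential
  quantifier.
\<close>

lemma definable_pred_plug:
  assumes t: "definable_term D I h t" and h: "range h = D s"
    and Q: "definable_pred D I (\<lambda>v. Q (\<lambda>i. v (Suc i)) (v 0))"
  shows "definable_pred D I (\<lambda>v. Q v (h (t v)))"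
proof -
  have "definable_pred D I (\<lambda>v. \<exists>e\<in>D s. e = h (t v) \<and> Q v e)"
    using t Q unfolding definable_term_def by (intro definable_pred_ex definable_pred_conj)
  moreover have "(\<exists>e\<in>D s. e = h (t v) \<and> Q v e) \<longleftrightarrow> Q v (h (t v))" for v
    using h by auto
  ultimately show ?thesis by simp
qed

lemma definable_term_const: "range h = D s \<Longrightarrow> definable_term D I h (\<lambda>v. c)"
  unfolding definable_term_def by (intro definable_pred_eq) (auto intro: atomic_const)

text \<open>
  The function \<open>inv h\<close> decodes an element of the sort. Outside the sort it has a fixed
  value, which makes the decoded variable definable on all valuations.
\<close>

lemma definable_term_var:
  assumes h: "inj h" "range h = D s"
  shows "definable_term D I h (\<lambda>v. inv h (v c))"
proof -
  have "definable_pred D I (\<lambda>v. v (Suc c) \<in> D s \<and> v 0 = v (Suc c) \<or>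
      \<not> v (Suc c) \<in> D s \<and> v 0 = h (SOME y. False))"
    using h(2) by (intro definable_pred_disj definable_pred_conj definable_pred_not
        definable_pred_eq definable_pred_in_sort) (auto intro: atomic_const)
  moreover have "v (Suc c) \<in> D s \<and> v 0 = v (Suc c) \<or>
      \<not> v (Suc c) \<in> D s \<and> v 0 = h (SOME y. False) \<longleftrightarrow> v 0 = h (inv h (v (Suc c)))" for v
  proof (cases "v (Suc c) \<in> D s")
    case True
    then have "h (inv h (v (Suc c))) = v (Suc c)" unfolding h(2)[symmetric] by (rule f_inv_into_f)
    then show ?thesis using True by simp
  next
    case False
    then have "inv h (v (Suc c)) = (SOME y. False)"
      unfolding h(2)[symmetric] inv_into_def by (metis rangeI)
    then show ?thesis using False by simp
  qed
  ultimately show ?thesis by (simp add: definable_term_def)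
qed

lemma definable_pred_eq_terms:
  assumes "definable_term D I h t" "definable_term D I h t'" "inj h" "range h = D s"
  shows "definable_pred D I (\<lambda>v. t v = t' v)"
proof -
  have "definable_pred D I (\<lambda>v. h (t' v) = h (t v))"
    using definable_pred_plug[OF assms(2,4), where Q = "\<lambda>v e. e = h (t v)"] assms(1)
    by (simp add: definable_term_def)
  moreover have "h (t' v) = h (t v) \<longleftrightarrow> t v = t' v" for v
    using assms(3) by (auto dest: injD)
  ultimately show ?thesis by simp
qed

lemma definable_pred_ex_type:
  assumes h: "inj h" "range h = D s"
    and Q: "definable_pred D I (\<lambda>v. Q (\<lambda>i. v (Suc i)) (inv h (v 0)))"
  shows "definable_pred D I (\<lambda>v. \<exists>x. Q v x)"
proof -
  have "definable_pred D I (\<lambda>v. \<exists>e\<in>D s. Q v (inv h e))"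
    using Q by (intro definable_pred_ex)
  moreover have "(\<exists>e\<in>D s. Q v (inv h e)) \<longleftrightarrow> (\<exists>x. Q v x)" for v
    using h by (metis inv_f_f rangeI)
  ultimately show ?thesis by simp
qed

section \<open>Fields with a definable finite power set\<close>

lemma finite_power_setD:
  assumes "finite_power_set mem X Y R"
  shows finite_power_set_subset: "R \<subseteq> X \<times> Y"
    and finite_power_set_definable: "eq_definable mem {x @ B | x B. (x, B) \<in> R}"
    and finite_power_set_ext_eqD: "\<lbrakk>B \<in> Y; C \<in> Y; ext R B = ext R C\<rbrakk> \<Longrightarrow> B = C"
    and finite_power_set_empty: "\<exists>E\<in>Y. ext R E = {}"
    and finite_power_set_singleton: "a \<in> X \<Longrightarrow> \<exists>S\<in>Y. ext R S = {a}"
    and finite_power_set_union: "\<lbrakk>B \<in> Y; C \<in> Y\<rbrakk> \<Longrightarrow> \<exists>U\<in>Y. ext R U = ext R B \<union> ext R C"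
    and finite_power_set_induct: "\<lbrakk>\<U> \<subseteq> Y; eq_definable mem \<U>;
        \<And>E. \<lbrakk>E \<in> Y; ext R E = {}\<rbrakk> \<Longrightarrow> E \<in> \<U>;
        \<And>B x C. \<lbrakk>B \<in> \<U>; x \<in> X; C \<in> Y; ext R C = insert x (ext R B)\<rbrakk> \<Longrightarrow> C \<in> \<U>\<rbrakk> \<Longrightarrow> \<U> = Y"
proof -
  note * = assms[unfolded finite_power_set_def]
  show "R \<subseteq> X \<times> Y" using * by (elim conjE)
  show "eq_definable mem {x @ B | x B. (x, B) \<in> R}" using * by (elim conjE)
  have "\<forall>B\<in>Y. \<forall>C\<in>Y. B = C \<longleftrightarrow> ext R B = ext R C" using * by (elim conjE)
  then show "\<lbrakk>B \<in> Y; C \<in> Y; ext R B = ext R C\<rbrakk> \<Longrightarrow> B = C" by blast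
  show "\<exists>E\<in>Y. ext R E = {}" using * by (elim conjE)
  have "\<forall>a\<in>X. \<exists>S\<in>Y. ext R S = {a}" using * by (elim conjE)
  then show "a \<in> X \<Longrightarrow> \<exists>S\<in>Y. ext R S = {a}" by blast
  have "\<forall>B\<in>Y. \<forall>C\<in>Y. \<exists>U\<in>Y. ext R U = ext R B \<union> ext R C" using * by (elim conjE)
  then show "\<lbrakk>B \<in> Y; C \<in> Y\<rbrakk> \<Longrightarrow> \<exists>U\<in>Y. ext R U = ext R B \<union> ext R C" by blast
  have "\<forall>\<U>. \<U> \<subseteq> Y \<and> eq_definable mem \<U> \<and>
        (\<forall>E\<in>Y. ext R E = {} \<longrightarrow> E \<in> \<U>) \<and>
        (\<forall>B\<in>\<U>. \<forall>x\<in>X. \<forall>C\<in>Y. ext R C = insert x (ext R B) \<longrightarrow> C \<in> \<U>)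
        \<longrightarrow> \<U> = Y" using * by (elim conjE)
  then have imp: "\<U> \<subseteq> Y \<and> eq_definable mem \<U> \<and>
        (\<forall>E\<in>Y. ext R E = {} \<longrightarrow> E \<in> \<U>) \<and>
        (\<forall>B\<in>\<U>. \<forall>x\<in>X. \<forall>C\<in>Y. ext R C = insert x (ext R B) \<longrightarrow> C \<in> \<U>)
        \<longrightarrow> \<U> = Y" by (rule spec)
  show "\<U> = Y" if "\<U> \<subseteq> Y" "eq_definable mem \<U>"
    "\<And>E. \<lbrakk>E \<in> Y; ext R E = {}\<rbrakk> \<Longrightarrow> E \<in> \<U>"
    "\<And>B x C. \<lbrakk>B \<in> \<U>; x \<in> X; C \<in> Y; ext R C = insert x (ext R B)\<rbrakk> \<Longrightarrow> C \<in> \<U>"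
  proof (rule imp[THEN mp], intro conjI ballI impI)
    show "\<U> \<subseteq> Y" "eq_definable mem \<U>" by (rule that)+
    show "E \<in> \<U>" if "E \<in> Y" "ext R E = {}" for E
      using that by (rule \<open>\<And>E. \<lbrakk>E \<in> Y; ext R E = {}\<rbrakk> \<Longrightarrow> E \<in> \<U>\<close>)
    show "C \<in> \<U>" if "B \<in> \<U>" "x \<in> X" "C \<in> Y" "ext R C = insert x (ext R B)" for B x C
      using that by (rule \<open>\<And>B x C. \<lbrakk>B \<in> \<U>; x \<in> X; C \<in> Y; ext R C = insert x (ext R B)\<rbrakk> \<Longrightarrow> C \<in> \<U>\<close>)
  qed
qed

text \<open>
  Injective on the natural numbers: since \<open>y \<le> x + y\<close>, the code is at least the square of \<open>x + y\<close>
  and less than the square of \<open>x + y + 1\<close>, so it determines \<open>x + y\<close> and then \<open>y\<close>. Being a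
  polynomial, it is a definable term.
\<close>

definition pair_code :: "'a::field \<Rightarrow> 'a \<Rightarrow> 'a" where
  "pair_code x y = (x + y) * (x + y) + y"

locale finite_power_char_zero =
  fixes mem :: "'a::field \<Rightarrow> 'f \<Rightarrow> bool"
  assumes field: "finite_power_field mem"
    and char_zero: "definable_char_zero mem"
begin

abbreviation dpred :: "((nat \<Rightarrow> ('a, 'f) eel) \<Rightarrow> bool) \<Rightarrow> bool" where
  "dpred \<equiv> definable_pred (edom mem) (eint mem)"

abbreviation dfld :: "((nat \<Rightarrow> ('a, 'f) eel) \<Rightarrow> 'a) \<Rightarrow> bool" where
  "dfld \<equiv> definable_term (edom mem) (eint mem) fld"

abbreviation dfin :: "((nat \<Rightarrow> ('a, 'f) eel) \<Rightarrow> 'f) \<Rightarrow> bool" where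
  "dfin \<equiv> definable_term (edom mem) (eint mem) fin"

abbreviation un_fld :: "('a, 'f) eel \<Rightarrow> 'a" where
  "un_fld \<equiv> inv fld"

abbreviation un_fin :: "('a, 'f) eel \<Rightarrow> 'f" where
  "un_fin \<equiv> inv fin"

abbreviation le (infix "\<preceq>" 50) where
  "x \<preceq> y \<equiv> nats_le mem x y"

abbreviation N where
  "N \<equiv> nats mem"

lemma inj_fld: "inj (fld :: 'a \<Rightarrow> ('a, 'f) eel)" and inj_fin: "inj (fin :: 'f \<Rightarrow> ('a, 'f) eel)"
  by (auto intro: injI)

lemma range_fld: "range fld = edom mem (Home FieldSort)"
  and range_fin: "range fin = edom mem (Home FinSort)"
  by (auto simp: image_image)

lemma un_fld [simp]: "un_fld (fld x) = x" and un_fin [simp]: "un_fin (fin F) = F"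
  by (rule inv_f_f[OF inj_fld] inv_f_f[OF inj_fin])+

subsection \<open>Closure rules\<close>

lemma dpred_plug_fld:
  "\<lbrakk>dfld t; dpred (\<lambda>v. Q (\<lambda>i. v (Suc i)) (v 0))\<rbrakk> \<Longrightarrow> dpred (\<lambda>v. Q v (fld (t v)))"
  by (rule definable_pred_plug[where D = "edom mem" and I = "eint mem" and s = "Home FieldSort" and h = fld, OF _ range_fld])

lemma dpred_plug_fin:
  "\<lbrakk>dfin t; dpred (\<lambda>v. Q (\<lambda>i. v (Suc i)) (v 0))\<rbrakk> \<Longrightarrow> dpred (\<lambda>v. Q v (fin (t v)))"
  by (rule definable_pred_plug[where D = "edom mem" and I = "eint mem" and s = "Home FinSort" and h = fin, OF _ range_fin])

text \<open>
  In the following rules, the element of the structure bound by a quantifier appears as a variable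
  \<open>v 0\<close> decoded by \<open>un_fld\<close> or \<open>un_fin\<close>.
\<close>

lemma dpred_ex_fld: "dpred (\<lambda>v. Q (\<lambda>i. v (Suc i)) (un_fld (v 0))) \<Longrightarrow> dpred (\<lambda>v. \<exists>x. Q v x)"
  by (rule definable_pred_ex_type[where D = "edom mem" and I = "eint mem" and s = "Home FieldSort" and h = fld, OF inj_fld range_fld])

lemma dpred_ex_fin: "dpred (\<lambda>v. Q (\<lambda>i. v (Suc i)) (un_fin (v 0))) \<Longrightarrow> dpred (\<lambda>v. \<exists>F. Q v F)"
  by (rule definable_pred_ex_type[where D = "edom mem" and I = "eint mem" and s = "Home FinSort" and h = fin, OF inj_fin range_fin])

lemma dpred_all_fld: "dpred (\<lambda>v. Q (\<lambda>i. v (Suc i)) (un_fld (v 0))) \<Longrightarrow> dpred (\<lambda>v. \<forall>x. Q v x)"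
  using definable_pred_not[OF dpred_ex_fld[OF definable_pred_not]] by simp

lemma dpred_all_fin: "dpred (\<lambda>v. Q (\<lambda>i. v (Suc i)) (un_fin (v 0))) \<Longrightarrow> dpred (\<lambda>v. \<forall>F. Q v F)"
  using definable_pred_not[OF dpred_ex_fin[OF definable_pred_not]] by simp

lemma dpred_eq_fld: "\<lbrakk>dfld t; dfld t'\<rbrakk> \<Longrightarrow> dpred (\<lambda>v. t v = t' v)"
  by (rule definable_pred_eq_terms[where D = "edom mem" and I = "eint mem" and s = "Home FieldSort" and h = fld, OF _ _ inj_fld range_fld])

lemma dfld_var: "dfld (\<lambda>v. un_fld (v i))" and dfin_var: "dfin (\<lambda>v. un_fin (v i))"
  by (rule definable_term_var[where D = "edom mem" and I = "eint mem" and s = "Home FieldSort" and h = fld, OF inj_fld range_fld] definable_term_var[where D = "edom mem" and I = "eint mem" and s = "Home FinSort" and h = fin, OF inj_fin range_fin])+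

lemma dfld_const: "dfld (\<lambda>v. c)" and dfin_const: "dfin (\<lambda>v. F)"
  by (rule definable_term_const[where D = "edom mem" and I = "eint mem" and s = "Home FieldSort" and h = fld, OF range_fld] definable_term_const[where D = "edom mem" and I = "eint mem" and s = "Home FinSort" and h = fin, OF range_fin])+

lemma dpred_atom: "dpred (\<lambda>v. eint mem (HomeRel r) [v i, v j, v k])"
  "dpred (\<lambda>v. eint mem (HomeRel r) [v i, v j])"
  using definable_pred_rel[of "edom mem" "eint mem" "HomeRel r" "[i, j, k]"]
    definable_pred_rel[of "edom mem" "eint mem" "HomeRel r" "[i, j]"] by simp_all

lemma dpred_mem:
  assumes "dfld t" "dfin T"
  shows "dpred (\<lambda>v. mem (t v) (T v))"
proof -
  have "dpred (\<lambda>v. eint mem (HomeRel MemRel) [fld (t v), fin (T v)])"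
    by (intro dpred_plug_fld[where Q = "\<lambda>v e. eint mem (HomeRel MemRel) [e, fin (T v)]"]
        dpred_plug_fin[where Q = "\<lambda>v e. eint mem (HomeRel MemRel) [v 0, e]"]
        assms definable_term_shift[OF assms(2)] dpred_atom)
  moreover have "eint mem (HomeRel MemRel) [fld x, fin F] \<longleftrightarrow> mem x F" for x F
    by (auto simp: Cons_eq_map_conv)
  ultimately show ?thesis by simp
qed

lemma dfld_ring:
  assumes t: "dfld t" "dfld t'"
  shows "dfld (\<lambda>v. t v + t' v)" "dfld (\<lambda>v. t v - t' v)" "dfld (\<lambda>v. t v * t' v)"
proof -
  have rel: "eint mem (HomeRel AddRel) [fld x, fld y, e] \<longleftrightarrow> e = fld (x + y)"
    "eint mem (HomeRel AddRel) [fld x, e, fld y] \<longleftrightarrow> e = fld (y - x)"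
    "eint mem (HomeRel MulRel) [fld x, fld y, e] \<longleftrightarrow> e = fld (x * y)" for x y e
    by (auto simp: Cons_eq_map_conv eq_diff_eq add.commute intro!: exI[of _ "y - x"])
  note shift = t[THEN definable_term_shift] t[THEN definable_term_shift, THEN definable_term_shift]
  show "dfld (\<lambda>v. t v + t' v)"
    unfolding definable_term_def rel(1)[symmetric]
    by (intro dpred_plug_fld[where Q = "\<lambda>v e. eint mem (HomeRel AddRel) [e, fld (t' (\<lambda>i. v (Suc i))), v 0]"]
        dpred_plug_fld[where Q = "\<lambda>v e. eint mem (HomeRel AddRel) [v 0, e, v (Suc 0)]"]
        dpred_atom shift t)
  show "dfld (\<lambda>v. t v * t' v)"
    unfolding definable_term_def rel(3)[symmetric]
    by (intro dpred_plug_fld[where Q = "\<lambda>v e. eint mem (HomeRel MulRel) [e, fld (t' (\<lambda>i. v (Suc i))), v 0]"]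
        dpred_plug_fld[where Q = "\<lambda>v e. eint mem (HomeRel MulRel) [v 0, e, v (Suc 0)]"]
        dpred_atom shift t)
  show "dfld (\<lambda>v. t v - t' v)"
    unfolding definable_term_def rel(2)[symmetric]
    by (intro dpred_plug_fld[where Q = "\<lambda>v e. eint mem (HomeRel AddRel) [e, v 0, fld (t (\<lambda>i. v (Suc i)))]"]
        dpred_plug_fld[where Q = "\<lambda>v e. eint mem (HomeRel AddRel) [v 0, v (Suc 0), e]"]
        dpred_atom shift t)
qed

lemmas definable_connectives = definable_pred_conj definable_pred_disj definable_pred_not
  definable_pred_imp definable_pred_iff

lemmas dpred_base_intros = definable_connectives
  dpred_ex_fld dpred_ex_fin dpred_all_fld dpred_all_fin dpred_eq_fld dpred_mem
  dfld_var dfin_var dfld_ring dfld_const dfin_const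

lemma dpred_nats: "dfld t \<Longrightarrow> dpred (\<lambda>v. t v \<in> N)"
proof -
  have "dfld (\<lambda>v. un_fld (v 0)) \<Longrightarrow> dpred (\<lambda>v. un_fld (v 0) \<in> N)"
    unfolding nats_def mem_Collect_eq by (intro dpred_base_intros)
  then show "dfld t \<Longrightarrow> dpred (\<lambda>v. t v \<in> N)"
    using dpred_plug_fld[where Q = "\<lambda>v e. un_fld e \<in> N" and t = t] by (simp add: dfld_var)
qed

lemma dpred_ex_nats: "dpred (\<lambda>v. Q (\<lambda>i. v (Suc i)) (un_fld (v 0))) \<Longrightarrow> dpred (\<lambda>v. \<exists>x\<in>N. Q v x)"
  unfolding Bex_def by (intro dpred_ex_fld definable_pred_conj dpred_nats dfld_var)

lemma dpred_all_nats: "dpred (\<lambda>v. Q (\<lambda>i. v (Suc i)) (un_fld (v 0))) \<Longrightarrow> dpred (\<lambda>v. \<forall>x\<in>N. Q v x)"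
  unfolding Ball_def by (intro dpred_all_fld definable_pred_imp dpred_nats dfld_var)

lemma dpred_le: "\<lbrakk>dfld t; dfld t'\<rbrakk> \<Longrightarrow> dpred (\<lambda>v. t v \<preceq> t' v)"
  unfolding nats_le_def by (intro dpred_nats dfld_ring)

lemma dfld_pair_code: "\<lbrakk>dfld t; dfld t'\<rbrakk> \<Longrightarrow> dfld (\<lambda>v. pair_code (t v) (t' v))"
  unfolding pair_code_def by (intro dfld_ring)

lemma dpred_seg: "dfld t \<Longrightarrow> dpred (\<lambda>v. t v \<in> seg mem n)"
  unfolding seg_def mem_Collect_eq
  by (intro definable_connectives dpred_nats dpred_le dpred_eq_fld dfld_const)

lemmas dpred_arith_intros = definable_connectives
  dpred_ex_nats dpred_all_nats dpred_seg dpred_nats dpred_le dpred_eq_fld dpred_mem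
  dpred_ex_fld dpred_ex_fin dpred_all_fld dpred_all_fin
  dfld_pair_code dfld_var dfin_var dfld_ring dfld_const dfin_const

subsection \<open>Induction and comprehension\<close>

lemma definable_fin:
  assumes "dpred (\<lambda>v. Q (un_fin (v 0)))"
  shows "eq_definable mem {[fin F] | F. Q F}"
proof -
  have "{[fin F] | F. Q F} = {xs \<in> tuples (edom mem) [Home FinSort].
      Q (un_fin (if (0::nat) < length [Home FinSort] then xs ! 0 else fin undefined))}"
    by (auto simp: tuples_Cons)
  also have "eq_definable mem \<dots>"
    by (rule definable_tuples_pred[OF assms, where c = "fin undefined" and s = "Home FinSort"]) simp
  finally show ?thesis .
qed

abbreviation field_membership :: "(('a, 'f) eel list \<times> ('a, 'f) eel list) set" where
  "field_membership \<equiv> {([fld a], [fin F]) | a F. mem a F}"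

lemma field_mem:
  "finite_power_set mem {[fld a] | a. True} {[fin F] | F. True} field_membership"
  using field by (simp only: finite_power_field_def)

lemma ext_field_membership [simp]: "ext field_membership [fin F] = {[fld a] | a. mem a F}"
  by (auto simp: ext_def)

lemma fin_eqI:
  assumes "\<And>x. mem x F \<longleftrightarrow> mem x G"
  shows "F = G"
proof -
  have "ext field_membership [fin F] = ext field_membership [fin G]"
    unfolding ext_field_membership assms ..
  then have "[fin F :: ('a, 'f) eel] = [fin G]"
    by (intro finite_power_set_ext_eqD[OF field_mem]) blast+
  then show ?thesis by simp
qed

lemma fin_empty: "\<exists>F. \<forall>x. \<not> mem x F"
proof -
  obtain F where "ext field_membership [fin F] = {}"
    using finite_power_set_empty[OF field_mem] by blast
  then show ?thesis unfolding ext_field_membership by blast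
qed

lemma eq_field_singletons_iff:
  "{[fld a :: ('a, 'f) eel] | a. Q a} = {[fld a] | a. Q' a} \<longleftrightarrow> (\<forall>x. Q x \<longleftrightarrow> Q' x)"
proof
  assume eq: "{[fld a :: ('a, 'f) eel] | a. Q a} = {[fld a] | a. Q' a}"
  show "\<forall>x. Q x \<longleftrightarrow> Q' x"
  proof
    fix x
    have "[fld x] \<in> {[fld a :: ('a, 'f) eel] | a. Q a} \<longleftrightarrow>
        [fld x] \<in> {[fld a :: ('a, 'f) eel] | a. Q' a}"
      unfolding eq by (rule refl)
    then show "Q x \<longleftrightarrow> Q' x" by simp
  qed
qed simp

lemma fin_union: "\<exists>H. \<forall>x. mem x H \<longleftrightarrow> mem x F \<or> mem x G"
proof -
  obtain H where "ext field_membership [fin H] = ext field_membership [fin F] \<union> ext field_membership [fin G]"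
    using finite_power_set_union[OF field_mem, of "[fin F]" "[fin G]"] by blast
  then have "{[fld a :: ('a, 'f) eel] | a. mem a H} = {[fld a] | a. mem a F \<or> mem a G}"
    by (simp only: ext_field_membership) blast
  then show ?thesis unfolding eq_field_singletons_iff by blast
qed

lemma fin_singleton: "\<exists>F. \<forall>y. mem y F \<longleftrightarrow> y = x"
proof -
  obtain F where "ext field_membership [fin F] = {[fld x]}"
    using finite_power_set_singleton[OF field_mem, of "[fld x]"] by blast
  then have "{[fld a :: ('a, 'f) eel] | a. mem a F} = {[fld a] | a. a = x}"
    by (simp only: ext_field_membership) blast
  then show ?thesis unfolding eq_field_singletons_iff by blast
qed

lemma fin_insert: "\<exists>G. \<forall>y. mem y G \<longleftrightarrow> y = x \<or> mem y F"
  by (metis fin_singleton fin_union)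

lemma fin_induct [case_names definable empty insert]:
  assumes "dpred (\<lambda>v. Q (un_fin (v 0)))"
    and empty: "\<And>F. (\<And>x. \<not> mem x F) \<Longrightarrow> Q F"
    and ins: "\<And>F G x. \<lbrakk>Q F; \<And>y. mem y G \<longleftrightarrow> y = x \<or> mem y F\<rbrakk> \<Longrightarrow> Q G"
  shows "Q F"
proof -
  let ?U = "{[fin F :: ('a, 'f) eel] | F. Q F}"
  have "?U = {[fin F] | F. True}"
  proof (rule finite_power_set_induct[OF field_mem])
    show "eq_definable mem ?U" using assms(1) by (rule definable_fin)
    show "E \<in> ?U" if E': "E \<in> {[fin F] | F. True}" and E: "ext field_membership E = {}" for E
    proof -
      obtain F where "E = [fin F]" using E' by blast
      then show ?thesis using empty E by auto
    qed
    show "C \<in> ?U"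
      if B: "B \<in> ?U" and x: "x \<in> {[fld a] | a. True}" and C: "C \<in> {[fin F] | F. True}"
        and *: "ext field_membership C = insert x (ext field_membership B)" for B x C
    proof -
      obtain F where F: "B = [fin F]" "Q F" using B by blast
      obtain a where a: "x = [fld a]" using x by blast
      obtain G where G: "C = [fin G]" using C by blast
      have "{[fld b :: ('a, 'f) eel] | b. mem b G} = {[fld b] | b. b = a \<or> mem b F}"
        using * unfolding F(1) a G ext_field_membership by blast
      then have "Q G" unfolding eq_field_singletons_iff using ins[OF F(2)] by blast
      then show ?thesis using G by blast
    qed
  qed blast
  then have "[fin F] \<in> ?U" by blast
  then show ?thesis by simp
qed

lemma fin_comprehension:
  assumes "dpred (\<lambda>v. Q (un_fld (v 0)))"
  shows "\<exists>G. \<forall>x. mem x G \<longleftrightarrow> mem x F \<and> Q x"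
proof -
  have Q: "dpred (\<lambda>v. Q (un_fld (v i)))" for i
    using definable_pred_subst[OF assms, where f = "\<lambda>_ v. v i"] by simp
  show ?thesis
  proof (induction F rule: fin_induct)
    case definable
    show ?case by (intro Q dpred_arith_intros)
  next
    case (empty F)
    then show ?case by blast
  next
    case (insert F G x)
    then obtain H where H: "\<And>y. mem y H \<longleftrightarrow> mem y F \<and> Q y" by blast
    obtain H' where H': "\<And>y. mem y H' \<longleftrightarrow> y = x \<or> mem y H" using fin_insert by blast
    have "\<forall>y. mem y (if Q x then H' else H) \<longleftrightarrow> mem y G \<and> Q y"
      using insert.hyps H H' by auto
    then show ?case by blast
  qed
qed

text \<open>
  Translates serve to move a hypothetical counterexample to induction down to \<open>0\<close>.
\<close>

lemma fin_translate: "\<exists>G. \<forall>y. mem y G \<longleftrightarrow> mem (y + x) F"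
proof (induction F rule: fin_induct)
  case definable
  show ?case by (intro dpred_arith_intros)
next
  case (empty F)
  then show ?case using fin_empty by blast
next
  case (insert F G z)
  then obtain H where H: "\<And>y. mem y H \<longleftrightarrow> mem (y + x) F" by blast
  obtain H' where "\<And>y. mem y H' \<longleftrightarrow> y = z - x \<or> mem y H" using fin_insert by blast
  then have "\<forall>y. mem y H' \<longleftrightarrow> mem (y + x) G"
    using insert.hyps H by (auto simp: eq_diff_eq)
  then show ?case by blast
qed

section \<open>Arithmetic of the natural numbers\<close>

lemma natsI: "\<lbrakk>mem x F; \<And>z. \<lbrakk>mem z F; z \<noteq> 0\<rbrakk> \<Longrightarrow> mem (z - 1) F\<rbrakk> \<Longrightarrow> x \<in> N"
  unfolding nats_def by blast

lemma natsE:
  assumes "x \<in> N"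
  obtains F where "mem x F" "\<forall>z. mem z F \<longrightarrow> z \<noteq> 0 \<longrightarrow> mem (z - 1) F"
  using assms unfolding nats_def by blast

lemma nats_0: "0 \<in> N"
proof -
  obtain F where F: "\<And>y. mem y F \<longleftrightarrow> y = 0" using fin_singleton by blast
  show ?thesis by (rule natsI[of _ F]) (simp_all add: F)
qed

lemma nats_Suc:
  assumes "x \<in> N"
  shows "x + 1 \<in> N"
proof -
  obtain F where F: "mem x F" and pred: "\<forall>z. mem z F \<longrightarrow> z \<noteq> 0 \<longrightarrow> mem (z - 1) F"
    using assms by (rule natsE)
  obtain G where G: "\<And>y. mem y G \<longleftrightarrow> y = x + 1 \<or> mem y F" using fin_insert by blast
  show ?thesis
  proof (rule natsI[of _ G])
    show "mem (x + 1) G" by (simp add: G)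
    show "mem (z - 1) G" if "mem z G" "z \<noteq> 0" for z
      using that F pred[rule_format, of z] unfolding G by (elim disjE) simp_all
  qed
qed

lemma nats_pred:
  assumes "x \<in> N" "x \<noteq> 0"
  shows "x - 1 \<in> N"
proof -
  obtain F where F: "mem x F" and pred: "\<forall>z. mem z F \<longrightarrow> z \<noteq> 0 \<longrightarrow> mem (z - 1) F"
    using assms(1) by (rule natsE)
  show ?thesis using pred[rule_format, OF F assms(2)] pred[rule_format] by (rule natsI)
qed

lemma minus_1_notin: "- 1 \<notin> N"
  using char_zero by (simp add: definable_char_zero_def)

text \<open>
  Take a witness \<open>F\<close> for \<open>x \<in> N\<close>, that is, a hyperfinite set containing \<open>x\<close> and closed under
  predecessors of nonzero elements. If \<open>Q x\<close> fails, the counterexamples in \<open>F\<close> form a hyperfinite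
  set \<open>G\<close> that contains \<open>x\<close> and omits \<open>0\<close>, and \<open>G\<close> is closed under subtraction of \<open>1\<close> without
  exception. Its translate by \<open>- x\<close> is closed in the same way and contains \<open>0\<close>, hence \<open>- 1\<close>. So
  \<open>- 1\<close> is a natural number, against characteristic zero.
\<close>

lemma nats_induct [consumes 1, case_names definable 0 Suc]:
  assumes x: "x \<in> N" and Q: "dpred (\<lambda>v. Q (un_fld (v 0)))"
    and "Q 0" and step: "\<And>x. \<lbrakk>x \<in> N; Q x\<rbrakk> \<Longrightarrow> Q (x + 1)"
  shows "Q x"
proof (rule ccontr)
  assume "\<not> Q x"
  obtain F where F: "mem x F" and pred: "\<forall>z. mem z F \<longrightarrow> z \<noteq> 0 \<longrightarrow> mem (z - 1) F"
    using x by (rule natsE)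
  have FN: "z \<in> N" if "mem z F" for z
    using that pred[rule_format] by (rule natsI)
  obtain G where G: "\<And>z. mem z G \<longleftrightarrow> mem z F \<and> \<not> Q z"
    using fin_comprehension[where Q = "\<lambda>z. \<not> Q z", OF definable_pred_not[OF Q]] by blast
  obtain H where H: "\<And>z. mem z H \<longleftrightarrow> mem (z + x) G" using fin_translate by blast
  have G_pred: "mem (z - 1) G" if "mem z G" for z
  proof -
    have z: "mem z F" "\<not> Q z" using that by (simp_all add: G)
    then have "z \<noteq> 0" using \<open>Q 0\<close> by metis
    then have "mem (z - 1) F" using pred z by simp
    moreover have "\<not> Q (z - 1)"
      using step[OF FN[OF \<open>mem (z - 1) F\<close>]] z by auto
    ultimately show ?thesis by (simp add: G)
  qed
  have "- 1 \<in> N"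
  proof (rule natsI)
    have "mem x G" using F \<open>\<not> Q x\<close> by (simp add: G)
    then show "mem (- 1) H" using G_pred[of x] by (simp add: H)
    show "mem (z - 1) H" if "mem z H" for z
      using that G_pred[of "z + x"] by (simp add: H algebra_simps)
  qed
  then show False using minus_1_notin by blast
qed

lemma nats_add: "x + y \<in> N" if "x \<in> N" "y \<in> N"
  using \<open>y \<in> N\<close>
proof (induction y rule: nats_induct)
  case definable
  show ?case by (intro dpred_arith_intros)
next
  case (Suc y)
  then show ?case using nats_Suc[of "x + y"] by (simp add: add.assoc)
qed (use that in simp)

lemma nats_mult: "x * y \<in> N" if "x \<in> N" "y \<in> N"
  using \<open>y \<in> N\<close>
proof (induction y rule: nats_induct)
  case definable
  show ?case by (intro dpred_arith_intros)
next
  case (Suc y)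
  then show ?case using nats_add[OF Suc.IH that(1)] by (simp add: distrib_left)
qed (simp add: nats_0)

lemma nats_1: "1 \<in> N" using nats_Suc[OF nats_0] by simp

lemma pair_code_nats: "\<lbrakk>x \<in> N; y \<in> N\<rbrakk> \<Longrightarrow> pair_code x y \<in> N"
  by (simp add: pair_code_def nats_add nats_mult)

lemma le_refl [simp]: "x \<preceq> x" and zero_le: "x \<in> N \<Longrightarrow> 0 \<preceq> x"
  by (simp_all add: nats_le_def nats_0)

lemma le_trans: "\<lbrakk>x \<preceq> y; y \<preceq> z\<rbrakk> \<Longrightarrow> x \<preceq> z"
  unfolding nats_le_def using nats_add[of "y - x" "z - y"] by simp

text \<open>
  If \<open>x\<close> is nonzero, then \<open>- x\<close> and \<open>x - 1\<close> add up to \<open>- 1\<close>. This is what makes the order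
  antisymmetric.
\<close>

lemma nats_uminus: "x \<in> N \<Longrightarrow> - x \<in> N \<Longrightarrow> x = 0"
  using nats_add[of "- x" "x - 1"] nats_pred[of x] minus_1_notin by auto

lemma le_antisym: "\<lbrakk>x \<preceq> y; y \<preceq> x\<rbrakk> \<Longrightarrow> x = y"
  unfolding nats_le_def using nats_uminus[of "y - x"] by simp

lemma le_total: "x \<preceq> y \<or> y \<preceq> x" if "x \<in> N" "y \<in> N"
  using \<open>y \<in> N\<close>
proof (induction y rule: nats_induct)
  case definable
  show ?case by (intro dpred_arith_intros)
next
  case 0
  then show ?case using that by (simp add: nats_le_def)
next
  case (Suc y)
  from Suc.IH show ?case
  proof
    assume "x \<preceq> y"
    then show ?thesis using nats_Suc[of "y - x"] by (simp add: nats_le_def diff_add_eq)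
  next
    assume "y \<preceq> x"
    then show ?thesis
      using nats_pred[of "x - y"] nats_1
      by (cases "x = y") (simp_all add: nats_le_def diff_diff_eq)
  qed
qed

lemma le_add: "\<lbrakk>x \<preceq> x'; y \<preceq> y'\<rbrakk> \<Longrightarrow> x + y \<preceq> x' + y'"
  unfolding nats_le_def using nats_add[of "x' - x" "y' - y"] by (simp add: algebra_simps)

lemma le_mult: "\<lbrakk>x \<preceq> x'; y \<preceq> y'; x' \<in> N; y \<in> N\<rbrakk> \<Longrightarrow> x * y \<preceq> x' * y'"
  unfolding nats_le_def
  using nats_add[OF nats_mult[of "x' - x" y] nats_mult[of x' "y' - y"]] by (simp add: algebra_simps)

lemma le_add_right: "y \<in> N \<Longrightarrow> x \<preceq> x + y" and le_add_left: "y \<in> N \<Longrightarrow> x \<preceq> y + x"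
  by (simp_all add: nats_le_def)

lemma nats_of_le: "\<lbrakk>x \<in> N; x \<preceq> y\<rbrakk> \<Longrightarrow> y \<in> N"
  unfolding nats_le_def using nats_add[of x "y - x"] by simp

lemma le_Suc_iff: "x \<preceq> y + 1 \<longleftrightarrow> x \<preceq> y \<or> x = y + 1"
  unfolding nats_le_def
  by (metis add.commute add_diff_cancel_left' diff_add_eq eq_iff_diff_eq_0 nats_0 nats_Suc
      nats_pred add_diff_eq)

lemma lt_iff_Suc_le: "x \<preceq> y \<and> x \<noteq> y \<longleftrightarrow> x + 1 \<preceq> y"
proof
  show "x + 1 \<preceq> y" if "x \<preceq> y \<and> x \<noteq> y"
    using that nats_pred[of "y - x"] by (auto simp: nats_le_def diff_diff_eq)
  assume *: "x + 1 \<preceq> y"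
  have "x \<noteq> y" using * minus_1_notin by (auto simp: nats_le_def)
  moreover have "x \<preceq> y" using le_trans[OF le_add_right[OF nats_1] *] .
  ultimately show "x \<preceq> y \<and> x \<noteq> y" by blast
qed

lemma pair_code_mono:
  "\<lbrakk>x \<preceq> x'; y \<preceq> y'; x \<in> N; y \<in> N\<rbrakk> \<Longrightarrow> pair_code x y \<preceq> pair_code x' y'"
  unfolding pair_code_def using nats_of_le by (intro le_add le_mult nats_add) auto

lemma pair_code_less:
  assumes "x \<in> N" "y \<in> N" "x' \<in> N" "y' \<in> N" "x + y + 1 \<preceq> x' + y'"
  shows "pair_code x y \<noteq> pair_code x' y'"
proof -
  have "pair_code x y + 1 \<preceq> (x + y + 1) * (x + y + 1)"
  proof -
    have "(x + y + 1) * (x + y + 1) - (pair_code x y + 1) = x + x + y"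
      by (simp add: pair_code_def algebra_simps)
    moreover have "x + x + y \<in> N" using assms by (intro nats_add)
    ultimately show ?thesis unfolding nats_le_def by (simp only:)
  qed
  also have "(x + y + 1) * (x + y + 1) \<preceq> (x' + y') * (x' + y')"
    using assms by (intro le_mult nats_add nats_1)
  finally (le_trans) have "pair_code x y + 1 \<preceq> pair_code x' y'"
    unfolding pair_code_def using le_add_right[OF \<open>y' \<in> N\<close>] le_trans by blast
  then show ?thesis using lt_iff_Suc_le by blast
qed

lemma pair_code_inject:
  assumes "x \<in> N" "y \<in> N" "x' \<in> N" "y' \<in> N"
  shows "pair_code x y = pair_code x' y' \<longleftrightarrow> x = x' \<and> y = y'"
proof
  assume eq: "pair_code x y = pair_code x' y'"
  have "x + y = x' + y'"
    using le_total[of "x + y" "x' + y'"] lt_iff_Suc_le pair_code_less assms eq nats_add by metis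
  then show "x = x' \<and> y = y'" using eq by (simp add: pair_code_def)
qed simp

lemma fin_segment:
  assumes "m \<in> N"
  shows "\<exists>F. \<forall>x. mem x F \<longleftrightarrow> x \<in> N \<and> x \<preceq> m"
  using assms
proof (induction m rule: nats_induct)
  case definable
  show ?case by (intro dpred_arith_intros)
next
  case 0
  obtain F where "\<And>x. mem x F \<longleftrightarrow> x = 0" using fin_singleton by blast
  then show ?case using nats_uminus by (intro exI[of _ F]) (auto simp: nats_le_def nats_0)
next
  case (Suc m)
  then obtain F where F: "\<And>x. mem x F \<longleftrightarrow> x \<in> N \<and> x \<preceq> m" by blast
  obtain G where "\<And>x. mem x G \<longleftrightarrow> x = m + 1 \<or> mem x F" using fin_insert by blast
  then show ?case using F nats_Suc[OF Suc.hyps(1)] by (auto simp: le_Suc_iff intro!: exI[of _ G])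
qed

lemma bounded_comprehension:
  assumes "dpred (\<lambda>v. Q (un_fld (v 0)))" "m \<in> N" "\<And>x. Q x \<Longrightarrow> x \<in> N \<and> x \<preceq> m"
  shows "\<exists>F. \<forall>x. mem x F \<longleftrightarrow> Q x"
proof -
  obtain F where "\<And>x. mem x F \<longleftrightarrow> x \<in> N \<and> x \<preceq> m" using fin_segment[OF assms(2)] by blast
  moreover obtain G where "\<And>x. mem x G \<longleftrightarrow> mem x F \<and> Q x" using fin_comprehension[OF assms(1)] by blast
  ultimately show ?thesis using assms(3) by blast
qed

lemma nats_least:
  assumes Q: "dpred (\<lambda>v. Q (un_fld (v 0)))" and "m \<in> N" "Q m"
  shows "\<exists>k\<in>N. Q k \<and> (\<forall>j\<in>N. Q j \<longrightarrow> k \<preceq> j)"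
proof (rule ccontr)
  assume none: "\<not> ?thesis"
  have Q: "dpred (\<lambda>v. Q (un_fld (v i)))" for i
    using definable_pred_subst[OF Q, where f = "\<lambda>_ v. v i"] by simp
  have "\<forall>j\<in>N. Q j \<longrightarrow> x \<preceq> j" if "x \<in> N" for x
    using that
  proof (induction x rule: nats_induct)
    case definable
    show ?case by (intro Q dpred_arith_intros)
  next
    case (Suc x)
    then have "\<not> Q x" using none by blast
    then show ?case using Suc lt_iff_Suc_le by metis
  qed (auto intro: zero_le)
  then have "m + 1 \<preceq> m" using assms nats_Suc by blast
  then show False using minus_1_notin by (simp add: nats_le_def)
qed

end

section \<open>Hyperfiniteness from a coding by field elements\<close>

context finite_power_char_zero
begin

abbreviation dtuple :: "((nat \<Rightarrow> ('a, 'f) eel) \<Rightarrow> ('a, 'f) eel list) \<Rightarrow> bool" where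
  "dtuple \<equiv> atomic_tuple (edom mem)"

lemma dpred_in: "\<lbrakk>eq_definable mem B; dtuple t\<rbrakk> \<Longrightarrow> dpred (\<lambda>v. t v \<in> B)"
  by (rule definable_pred_in_definable)

lemma dpred_bex:
  assumes "eq_definable mem B" "B \<subseteq> tuples (edom mem) ss"
    and "dpred (\<lambda>v. Q (\<lambda>i. v (length ss + i)) (map v [0..<length ss]))"
  shows "dpred (\<lambda>v. \<exists>xs\<in>B. Q v xs)"
proof -
  have "dpred (\<lambda>v. \<exists>xs\<in>tuples (edom mem) ss. xs \<in> B \<and> Q v xs)"
    by (intro definable_pred_ex_tuple definable_pred_conj dpred_in assms atomic_tuple_map)
  moreover have "(\<exists>xs\<in>tuples (edom mem) ss. xs \<in> B \<and> Q v xs) \<longleftrightarrow> (\<exists>xs\<in>B. Q v xs)" for v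
    using assms(2) by blast
  ultimately show ?thesis by simp
qed

lemma dpred_ball:
  assumes "eq_definable mem B" "B \<subseteq> tuples (edom mem) ss"
    and "dpred (\<lambda>v. Q (\<lambda>i. v (length ss + i)) (map v [0..<length ss]))"
  shows "dpred (\<lambda>v. \<forall>xs\<in>B. Q v xs)"
proof -
  have "dpred (\<lambda>v. \<not> (\<exists>xs\<in>B. \<not> Q v xs))"
    by (rule definable_pred_not, rule dpred_bex[OF assms(1,2)], rule definable_pred_not, rule assms)
  then show ?thesis by simp
qed

lemma definable_tuple_set:
  assumes "dpred (\<lambda>v. Q (map v [0..<length ss]))"
  shows "eq_definable mem {xs \<in> tuples (edom mem) ss. Q xs}"
proof -
  have "map (\<lambda>i. if i < length ss then xs ! i else fin undefined) [0..<length ss] = xs"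
    if "xs \<in> tuples (edom mem) ss" for xs
    using that by (intro nth_equalityI) (auto simp: in_tuples_iff)
  then have "{xs \<in> tuples (edom mem) ss. Q xs} = {xs \<in> tuples (edom mem) ss.
      Q (map (\<lambda>i. if i < length ss then xs ! i else fin undefined) [0..<length ss])}"
    by auto
  also have "eq_definable mem \<dots>"
    by (rule definable_tuples_pred[OF assms, where s = "Home FinSort"]) simp
  finally show ?thesis .
qed

lemma dpred_in_fin:
  assumes "eq_definable mem \<U>" "dfin T"
  shows "dpred (\<lambda>v. [fin (T v)] \<in> \<U>)"
  by (rule dpred_plug_fin[where Q = "\<lambda>v e. [e] \<in> \<U>", OF assms(2)])
     (intro dpred_in assms(1) atomic_tuple_Cons atomic_var atomic_tuple_Nil)

text \<open>
  A definable injection \<open>c\<close> into the field identifies hyperfinite subsets of \<open>B\<close> with the elements of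
  the second sort whose extension lies in the image of \<open>c\<close>. All clauses but the last are inherited.
  For the induction clause, one shows by induction on \<open>F\<close> that the part of \<open>F\<close> inside the
  image represents an element of \<open>\<U>\<close>: inserting a point outside the image changes nothing.
\<close>

lemma hyperfinite_if_coded:
  assumes B: "eq_definable mem B" "B \<subseteq> tuples (edom mem) ss"
    and Q: "\<And>t s. \<lbrakk>dtuple t; dfld s\<rbrakk> \<Longrightarrow> dpred (\<lambda>v. Q (t v) (s v))"
    and c: "\<And>\<alpha> x. \<alpha> \<in> B \<Longrightarrow> Q \<alpha> x \<longleftrightarrow> x = c \<alpha>"
    and inj: "inj_on c B"
    and bound: "\<And>\<alpha>. \<alpha> \<in> B \<Longrightarrow> mem (c \<alpha>) F\<^sub>0"
  shows "hyperfinite mem B"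
proof -
  let ?m = "length ss"
  have code: "(\<exists>\<alpha>\<in>B. Q \<alpha> x) \<longleftrightarrow> x \<in> c ` B" for x using c by blast
  define good where "good F \<longleftrightarrow> (\<forall>x. mem x F \<longrightarrow> (\<exists>\<alpha>\<in>B. Q \<alpha> x))" for F
  have good: "x \<in> c ` B" if "good F" "mem x F" for x F
    using that unfolding good_def code by blast
  have goodI: "good F" if "\<And>x. mem x F \<Longrightarrow> x \<in> c ` B" for F
    using that unfolding good_def code by blast
  define Y where "Y = {[fin F :: ('a, 'f) eel] | F. good F}"
  define S where "S = {(\<alpha>, [fin F :: ('a, 'f) eel]) | \<alpha> F. \<alpha> \<in> B \<and> good F \<and> mem (c \<alpha>) F}"
  have ext_S: "ext S [fin F] = {\<alpha> \<in> B. mem (c \<alpha>) F}" if "good F" for F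
    using that by (auto simp: ext_def S_def)
  have mem_ext: "mem x F \<longleftrightarrow> (\<exists>\<alpha>\<in>ext S [fin F]. x = c \<alpha>)" if "good F" for x F
    unfolding ext_S[OF that] using good[OF that, of x] by blast
  have c_mem: "c \<alpha> = c \<beta> \<longleftrightarrow> \<alpha> = \<beta>" if "\<alpha> \<in> B" "\<beta> \<in> B" for \<alpha> \<beta>
    using that inj by (auto dest: inj_onD)
  have dpred_code: "dpred (\<lambda>v. \<exists>\<alpha>\<in>B. Q \<alpha> (un_fld (v i)))" for i
    by (intro dpred_bex[OF B] Q atomic_tuple_map dfld_var)
  have dpred_good: "dpred (\<lambda>v. good (un_fin (v i)))" for i
    unfolding good_def
    by (intro dpred_all_fld definable_pred_imp dpred_mem dpred_code dfld_var dfin_var)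
  have "finite_power_set mem B Y S"
    unfolding finite_power_set_def
  proof (intro conjI ballI allI impI)
    show "eq_definable mem B" by (rule B)
    show "eq_definable mem Y"
      unfolding Y_def by (rule definable_fin) (rule dpred_good)
    show "S \<subseteq> B \<times> Y" by (auto simp: S_def Y_def)
    show "eq_definable mem {x @ C | x C. (x, C) \<in> S}"
    proof -
      let ?ss = "ss @ [Home FinSort]"
      let ?Q = "\<lambda>xs. take ?m xs \<in> B \<and> good (un_fin (xs ! ?m)) \<and>
          (\<exists>x. mem x (un_fin (xs ! ?m)) \<and> Q (take ?m xs) x)"
      have "dpred (\<lambda>v. map v [0..<?m] \<in> B \<and> good (un_fin (v ?m)) \<and>
          (\<exists>x. mem x (un_fin (v ?m)) \<and> Q (map v [0..<?m]) x))"
        by (intro definable_pred_conj dpred_in B(1) dpred_good dpred_ex_fld dpred_mem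
            Q atomic_tuple_map dfld_var dfin_var)
      moreover have "take ?m (map v [0..<length ?ss]) = map v [0..<?m]"
        "map v [0..<length ?ss] ! ?m = v ?m" for v :: "nat \<Rightarrow> ('a, 'f) eel"
        by (simp_all add: take_map nth_append)
      ultimately have "eq_definable mem {xs \<in> tuples (edom mem) ?ss. ?Q xs}"
        by (intro definable_tuple_set) (simp only:)
      moreover have "{x @ C | x C. (x, C) \<in> S} = {xs \<in> tuples (edom mem) ?ss. ?Q xs}"
      proof (intro set_eqI iffI)
        fix xs assume "xs \<in> {x @ C | x C. (x, C) \<in> S}"
        then obtain \<alpha> F where *: "xs = \<alpha> @ [fin F]" "\<alpha> \<in> B" "good F" "mem (c \<alpha>) F"
          unfolding S_def by blast
        moreover have "\<alpha> \<in> tuples (edom mem) ss" using *(2) B(2) by blast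
        ultimately show "xs \<in> {xs \<in> tuples (edom mem) ?ss. ?Q xs}"
          by (auto simp: in_tuples_iff nth_append c less_Suc_eq)
      next
        fix xs assume "xs \<in> {xs \<in> tuples (edom mem) ?ss. ?Q xs}"
        then have xs: "xs \<in> tuples (edom mem) ?ss" and "?Q xs" by blast+
        have len: "length xs = Suc ?m" using xs by (simp add: in_tuples_iff)
        have "xs ! ?m \<in> edom mem (?ss ! ?m)"
          using xs unfolding in_tuples_iff by (metis length_append_singleton lessI)
        then obtain F where F: "xs ! ?m = fin F" by auto
        have "xs = take ?m xs @ [fin F]"
          using len F by (metis lessI take_Suc_conv_app_nth take_all order_refl)
        moreover have "(take ?m xs, [fin F]) \<in> S"
          using \<open>?Q xs\<close> F c unfolding S_def by auto
        ultimately show "xs \<in> {x @ C | x C. (x, C) \<in> S}" by blast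
      qed
      ultimately show ?thesis by simp
    qed
    show "U = C \<longleftrightarrow> ext S U = ext S C" if UC: "U \<in> Y" "C \<in> Y" for U C
    proof
      assume eq: "ext S U = ext S C"
      obtain F G where "U = [fin F]" "good F" "C = [fin G]" "good G"
        using UC unfolding Y_def by blast
      with eq mem_ext have "mem x F \<longleftrightarrow> mem x G" for x by simp
      then have "F = G" by (rule fin_eqI)
      then show "U = C" using \<open>U = [fin F]\<close> \<open>C = [fin G]\<close> by simp
    qed simp
    show "\<exists>E\<in>Y. ext S E = {}"
    proof -
      obtain F where F: "\<And>x. \<not> mem x F" using fin_empty by blast
      then have "good F" by (intro goodI) blast
      then show ?thesis using ext_S[of F] F unfolding Y_def by auto
    qed
    show "\<exists>C\<in>Y. ext S C = {\<alpha>}" if "\<alpha> \<in> B" for \<alpha>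
    proof -
      obtain F where F: "\<And>x. mem x F \<longleftrightarrow> x = c \<alpha>" using fin_singleton by blast
      then have "good F" using that by (intro goodI) blast
      moreover have "ext S [fin F] = {\<alpha>}"
        unfolding ext_S[OF \<open>good F\<close>] F using that c_mem by blast
      ultimately show ?thesis unfolding Y_def by blast
    qed
    show "\<exists>U\<in>Y. ext S U = ext S C \<union> ext S D" if CD: "C \<in> Y" "D \<in> Y" for C D
    proof -
      obtain F G where FG: "C = [fin F]" "good F" "D = [fin G]" "good G"
        using CD unfolding Y_def by blast
      obtain H where H: "\<And>x. mem x H \<longleftrightarrow> mem x F \<or> mem x G" using fin_union by blast
      then have "good H" using FG good by (intro goodI) blast
      moreover have "ext S [fin H] = ext S C \<union> ext S D"
        unfolding FG(1,3) ext_S[OF \<open>good H\<close>] ext_S[OF FG(2)] ext_S[OF FG(4)] H by blast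
      ultimately show ?thesis unfolding Y_def by blast
    qed
    fix \<U>
    assume U: "\<U> \<subseteq> Y \<and> eq_definable mem \<U> \<and>
        (\<forall>E\<in>Y. ext S E = {} \<longrightarrow> E \<in> \<U>) \<and>
        (\<forall>C\<in>\<U>. \<forall>x\<in>B. \<forall>D\<in>Y. ext S D = insert x (ext S C) \<longrightarrow> D \<in> \<U>)"
    have ind: "\<exists>G. [fin G] \<in> \<U> \<and> (\<forall>x. mem x G \<longleftrightarrow> mem x F \<and> (\<exists>\<alpha>\<in>B. Q \<alpha> x))" for F
    proof (induction F rule: fin_induct)
      case definable
      have "eq_definable mem \<U>" using U by blast
      then show ?case
        by (intro dpred_ex_fin dpred_all_fld definable_connectives dpred_in_fin dpred_mem dpred_code
            dfin_var dfld_var)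
    next
      case (empty F)
      then have "good F" by (intro goodI) blast
      then have "[fin F] \<in> Y" "ext S [fin F] = {}"
        using ext_S[of F] empty unfolding Y_def by auto
      then have "[fin F] \<in> \<U>" using U by blast
      then show ?case using empty by blast
    next
      case (insert F F' x)
      then obtain G where G: "[fin G] \<in> \<U>" "\<And>y. mem y G \<longleftrightarrow> mem y F \<and> (\<exists>\<alpha>\<in>B. Q \<alpha> y)"
        by blast
      then have goodG: "good G" unfolding good_def by blast
      show ?case
      proof (cases "\<exists>\<alpha>\<in>B. Q \<alpha> x")
        case False
        then have "\<forall>y. mem y G \<longleftrightarrow> mem y F' \<and> (\<exists>\<alpha>\<in>B. Q \<alpha> y)"
          using G(2) insert.hyps by auto
        then show ?thesis using G(1) by blast
      next
        case True
        then obtain \<alpha> where \<alpha>: "\<alpha> \<in> B" "x = c \<alpha>" using c by blast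
        obtain G' where G': "\<And>y. mem y G' \<longleftrightarrow> y = x \<or> mem y G" using fin_insert by blast
        have "good G'" using goodG True unfolding good_def G' by blast
        moreover have "ext S [fin G'] = insert \<alpha> (ext S [fin G])"
          unfolding ext_S[OF \<open>good G'\<close>] ext_S[OF goodG] G' using \<alpha> c_mem by blast
        ultimately have "[fin G'] \<in> \<U>" using U G(1) \<alpha>(1) unfolding Y_def by blast
        moreover have "\<forall>y. mem y G' \<longleftrightarrow> mem y F' \<and> (\<exists>\<alpha>\<in>B. Q \<alpha> y)"
          using G' G(2) insert.hyps True by auto
        ultimately show ?thesis by blast
      qed
    qed
    have "[fin F] \<in> \<U>" if "good F" for F
    proof -
      obtain G where G: "[fin G] \<in> \<U>" "\<And>x. mem x G \<longleftrightarrow> mem x F \<and> (\<exists>\<alpha>\<in>B. Q \<alpha> x)"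
        using ind by blast
      have "G = F" using G(2) that unfolding good_def by (intro fin_eqI) blast
      then show ?thesis using G(1) by simp
    qed
    then show "\<U> = Y" using U unfolding Y_def by blast
  qed
  moreover obtain F\<^sub>1 where F\<^sub>1: "\<And>x. mem x F\<^sub>1 \<longleftrightarrow> mem x F\<^sub>0 \<and> (\<exists>\<alpha>\<in>B. Q \<alpha> x)"
    using fin_comprehension[OF dpred_code] by blast
  moreover have "good F\<^sub>1" unfolding good_def F\<^sub>1 by blast
  moreover have "B = ext S [fin F\<^sub>1]"
    unfolding ext_S[OF \<open>good F\<^sub>1\<close>] F\<^sub>1 using bound c by blast
  ultimately show ?thesis unfolding hyperfinite_def Y_def by blast
qed

end

section \<open>Definable families of hyperfinite functions\<close>

locale definable_hyp_funs = finite_power_char_zero mem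
  for mem :: "'a::field \<Rightarrow> 'f \<Rightarrow> bool" +
  fixes n :: 'a
    and P A :: "('a, 'f) eel list set"
    and R :: "(('a, 'f) eel list \<times> ('a, 'f) eel list) set"
    and ss :: "esort list"
  assumes n: "n \<in> N"
    and P: "finite_power_set mem (seg_times_nats mem n) P R"
    and A: "eq_definable mem A"
    and A_hyp_funs: "A \<subseteq> hyp_funs mem n P R"
    and A_tuples: "A \<subseteq> tuples (edom mem) ss"
begin

abbreviation lt (infix "\<prec>" 50) where
  "x \<prec> y \<equiv> x \<preceq> y \<and> x \<noteq> y"

definition graph :: "('a, 'f) eel list \<Rightarrow> 'a \<Rightarrow> 'a \<Rightarrow> bool" where
  "graph \<alpha> i w \<longleftrightarrow> ([fld i, fld w], \<alpha>) \<in> R"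

definition bounded :: "'a \<Rightarrow> ('a, 'f) eel list \<Rightarrow> bool" where
  "bounded u \<alpha> \<longleftrightarrow> (\<forall>j\<in>N. \<forall>w\<in>N. graph \<alpha> j w \<longrightarrow> w \<preceq> u)"

definition below :: "'a \<Rightarrow> ('a, 'f) eel list \<Rightarrow> ('a, 'f) eel list \<Rightarrow> bool" where
  "below i \<beta> \<alpha> \<longleftrightarrow>
     (\<forall>j\<in>N. \<forall>w\<in>N. \<forall>w'\<in>N. j \<prec> i \<and> graph \<beta> j w \<and> graph \<alpha> j w' \<longrightarrow> w \<preceq> w')"

text \<open>
  The element \<open>F\<close> of the second sort is read as a hyperfinite set of constraints: the code of
  \<open>(j, w)\<close> requires the value \<open>w\<close> at \<open>j\<close>.
\<close>

definition satisfies :: "'f \<Rightarrow> ('a, 'f) eel list \<Rightarrow> bool" where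
  "satisfies F \<alpha> \<longleftrightarrow> (\<forall>j\<in>N. \<forall>w\<in>N. mem (pair_code j w) F \<longrightarrow> graph \<alpha> j w)"

lemma lt_0: "j \<in> N \<Longrightarrow> \<not> j \<prec> 0"
  using nats_uminus[of j] by (auto simp: nats_le_def)

lemma lt_Suc_iff: "j \<prec> i + 1 \<longleftrightarrow> j \<preceq> i"
  using le_Suc_iff[of j i] lt_iff_Suc_le[of i i] by auto

lemma graphD: "i \<in> seg mem n" "i \<in> N" "w \<in> N" if "graph \<alpha> i w"
proof -
  have "[fld i, fld w :: ('a, 'f) eel] \<in> seg_times_nats mem n"
    using that finite_power_set_subset[OF P] unfolding graph_def by blast
  then show "i \<in> seg mem n" "i \<in> N" "w \<in> N"
    by (auto simp: seg_times_nats_def seg_def)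
qed

lemma graph_iff: "w \<in> N \<and> [fld i, fld w] \<in> ext R \<alpha> \<longleftrightarrow> graph \<alpha> i w"
  using graphD(3)[of \<alpha> i w] by (auto simp: graph_def ext_def)

lemma graph_ex1:
  assumes "\<alpha> \<in> A" "i \<in> seg mem n"
  shows "\<exists>!w. graph \<alpha> i w"
proof -
  have "\<alpha> \<in> hyp_funs mem n P R" using A_hyp_funs assms(1) by (rule subsetD)
  then have "\<exists>!w. w \<in> N \<and> [fld i, fld w] \<in> ext R \<alpha>"
    using assms(2) unfolding hyp_funs_def by simp
  then show ?thesis unfolding graph_iff .
qed

lemma graph_unique: "\<lbrakk>\<alpha> \<in> A; graph \<alpha> i w; graph \<alpha> i w'\<rbrakk> \<Longrightarrow> w = w'"
  using graph_ex1[OF _ graphD(1)] by (rule ex1E) auto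

lemma graph_hyp_app: "\<lbrakk>\<alpha> \<in> A; i \<in> seg mem n\<rbrakk> \<Longrightarrow> graph \<alpha> i (hyp_app mem R \<alpha> i)"
  unfolding hyp_app_def graph_iff by (rule theI') (rule graph_ex1)

lemma graph_ext: "\<alpha> = \<beta>" if "\<alpha> \<in> A" "\<beta> \<in> A" and eq: "\<And>i w. graph \<alpha> i w \<longleftrightarrow> graph \<beta> i w"
proof (rule finite_power_set_ext_eqD[OF P])
  show "\<alpha> \<in> P" "\<beta> \<in> P" using that A_hyp_funs by (auto simp: hyp_funs_def)
  have sub: "ext R \<gamma> \<subseteq> seg_times_nats mem n" for \<gamma>
    using finite_power_set_subset[OF P] unfolding ext_def by blast
  have "x \<in> ext R \<alpha> \<longleftrightarrow> x \<in> ext R \<beta>" for x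
  proof (cases "x \<in> seg_times_nats mem n")
    case True
    then obtain i w where "x = [fld i, fld w]" unfolding seg_times_nats_def by blast
    then show ?thesis using eq[of i w] by (simp add: graph_def ext_def)
  qed (use sub in blast)
  then show "ext R \<alpha> = ext R \<beta>" by blast
qed

lemma bounded_mono: "bounded u \<alpha> \<Longrightarrow> u \<preceq> u' \<Longrightarrow> bounded u' \<alpha>"
  unfolding bounded_def using le_trans by blast

subsection \<open>Definability of the defining conditions\<close>

text \<open>
  The membership relation is given as a definable set of concatenated tuples. Its first components
  all have length two, so the concatenation can be split again.
\<close>

lemma dpred_graph:
  assumes t: "dtuple t" and i: "dfld i" and w: "dfld w"
  shows "dpred (\<lambda>v. graph (t v) (i v) (w v))"
proof -
  let ?X = "{x @ B | x B. (x, B) \<in> R}"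
  have "dtuple (\<lambda>v. t (\<lambda>i. v (Suc (Suc i))))"
    by (rule atomic_tuple_subst[OF t]) (rule atomic_var)
  then have "dpred (\<lambda>v. v (Suc 0) # v 0 # t (\<lambda>i. v (Suc (Suc i))) \<in> ?X)"
    by (intro dpred_in finite_power_set_definable[OF P] atomic_tuple_Cons atomic_var)
  then have "dpred (\<lambda>v. v 0 # fld (w (\<lambda>i. v (Suc i))) # t (\<lambda>i. v (Suc i)) \<in> ?X)"
    by (intro dpred_plug_fld[where Q = "\<lambda>v e. v 0 # e # t (\<lambda>i. v (Suc i)) \<in> ?X"]
        definable_term_shift[OF w])
  then have *: "dpred (\<lambda>v. fld (i v) # fld (w v) # t v \<in> ?X)"
    by (intro dpred_plug_fld[where Q = "\<lambda>v e. e # fld (w v) # t v \<in> ?X"] i)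
  have "fld i # fld w # \<alpha> \<in> ?X \<longleftrightarrow> graph \<alpha> i w" for i w \<alpha>
  proof
    assume "fld i # fld w # \<alpha> \<in> ?X"
    then obtain x B where x: "fld i # fld w # \<alpha> = x @ B" "(x, B) \<in> R" by blast
    then have "x \<in> seg_times_nats mem n" using finite_power_set_subset[OF P] by blast
    then obtain j k where "x = [fld j, fld k]" unfolding seg_times_nats_def by blast
    then show "graph \<alpha> i w" using x by (simp add: graph_def)
  next
    assume "graph \<alpha> i w"
    then have "([fld i, fld w], \<alpha>) \<in> R" by (simp add: graph_def)
    moreover have "fld i # fld w # \<alpha> = [fld i, fld w] @ \<alpha>" by simp
    ultimately show "fld i # fld w # \<alpha> \<in> ?X" by blast
  qed
  then show ?thesis using * by simp
qed

lemma dtuple_const: "\<alpha> \<in> A \<Longrightarrow> dtuple (\<lambda>v. \<alpha>)"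
proof -
  assume "\<alpha> \<in> A"
  then have "\<alpha> \<in> tuples (edom mem) ss" using A_tuples by blast
  then have "\<forall>x\<in>set \<alpha>. \<exists>s. x \<in> edom mem s"
    by (fastforce simp: in_tuples_iff in_set_conv_nth)
  then show ?thesis
    by (induction \<alpha>) (auto intro: atomic_tuple_Nil atomic_tuple_Cons atomic_const)
qed

lemmas dpred_intros = dpred_bex[OF A A_tuples] dpred_ball[OF A A_tuples] dpred_arith_intros
  dpred_graph atomic_tuple_map

subsection \<open>Bounded bases\<close>

lemma bounded_ex: "\<exists>u\<in>N. bounded u \<alpha>" if "\<alpha> \<in> A"
proof -
  have "\<exists>u\<in>N. \<forall>j\<in>N. \<forall>w\<in>N. j \<prec> i \<and> graph \<alpha> j w \<longrightarrow> w \<preceq> u" if "i \<in> N" for i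
    using that
  proof (induction i rule: nats_induct)
    case definable
    show ?case by (intro dpred_arith_intros dpred_graph dtuple_const \<open>\<alpha> \<in> A\<close>)
  next
    case 0
    show ?case using lt_0 nats_0 by blast
  next
    case (Suc i)
    then obtain u where u: "u \<in> N" "\<And>j w. \<lbrakk>j \<in> N; w \<in> N; j \<prec> i; graph \<alpha> j w\<rbrakk> \<Longrightarrow> w \<preceq> u"
      by blast
    have "\<exists>w\<^sub>0\<in>N. \<forall>w. graph \<alpha> i w \<longrightarrow> w = w\<^sub>0"
    proof (cases "\<exists>w. graph \<alpha> i w")
      case True
      then obtain w where w: "graph \<alpha> i w" ..
      show ?thesis using graphD(3)[OF w] graph_unique[OF \<open>\<alpha> \<in> A\<close> _ w] by blast
    qed (use nats_0 in blast)
    then obtain w\<^sub>0 where w\<^sub>0: "w\<^sub>0 \<in> N" "\<And>w. graph \<alpha> i w \<Longrightarrow> w = w\<^sub>0" by blast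
    have "w \<preceq> u + w\<^sub>0" if "j \<in> N" "w \<in> N" "j \<prec> i + 1" "graph \<alpha> j w" for j w
    proof (cases "j = i")
      case True
      then show ?thesis using w\<^sub>0 that le_add_left[OF u(1)] by blast
    next
      case False
      then have "w \<preceq> u" using u(2) that unfolding lt_Suc_iff by blast
      then show ?thesis using le_add_right[OF w\<^sub>0(1)] le_trans by blast
    qed
    then show ?case using nats_add[OF u(1) w\<^sub>0(1)] by blast
  qed
  from this[OF n] show ?thesis
    unfolding bounded_def using graphD(1) unfolding seg_def by blast
qed

text \<open>
  The functions satisfying \<open>F\<close>, compared only below \<open>i\<close>, have a basis bounded by some \<open>u\<close>. A formula
  in \<open>i\<close> and \<open>F\<close>, so that induction on \<open>i\<close> applies even with \<open>F\<close> universally quantified.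
\<close>

definition has_bounded_basis :: "'a \<Rightarrow> 'f \<Rightarrow> bool" where
  "has_bounded_basis i F \<longleftrightarrow> (\<exists>u\<in>N. \<forall>\<alpha>\<in>A. satisfies F \<alpha> \<longrightarrow>
     (\<exists>\<beta>\<in>A. satisfies F \<beta> \<and> bounded u \<beta> \<and> below i \<beta> \<alpha>))"

text \<open>
  The bound \<open>u\<^sub>0\<close> obtained by ignoring coordinate \<open>i\<close> takes care of all functions with a value of at
  least \<open>u\<^sub>0\<close> at \<open>i\<close>. The other values \<open>t\<close> are covered one by one by adding the constraint \<open>(i, t)\<close>.
\<close>

lemma bounded_basis_step:
  assumes i: "i \<in> N"
    and IH: "\<And>F. (\<And>j w. \<lbrakk>j \<in> N; w \<in> N; j \<prec> i\<rbrakk> \<Longrightarrow> \<not> mem (pair_code j w) F) \<Longrightarrow> has_bounded_basis i F"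
    and F: "\<And>j w. \<lbrakk>j \<in> N; w \<in> N; j \<prec> i + 1\<rbrakk> \<Longrightarrow> \<not> mem (pair_code j w) F"
  shows "has_bounded_basis (i + 1) F"
proof -
  have F_i: "\<not> mem (pair_code j w) F" if "j \<in> N" "w \<in> N" "j \<prec> i" for j w
    using F that unfolding lt_Suc_iff by blast
  obtain u\<^sub>0 where u\<^sub>0: "u\<^sub>0 \<in> N" "\<And>\<alpha>. \<lbrakk>\<alpha> \<in> A; satisfies F \<alpha>\<rbrakk> \<Longrightarrow>
      \<exists>\<beta>\<in>A. satisfies F \<beta> \<and> bounded u\<^sub>0 \<beta> \<and> below i \<beta> \<alpha>"
    using IH[OF F_i] unfolding has_bounded_basis_def by blast
  have below_Suc: "below (i + 1) \<beta> \<alpha>"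
    if "below i \<beta> \<alpha>" "\<And>w w'. \<lbrakk>graph \<beta> i w; graph \<alpha> i w'\<rbrakk> \<Longrightarrow> w \<preceq> w'" for \<alpha> \<beta>
    using that unfolding below_def lt_Suc_iff by metis
  \<comment> \<open>Functions with the same value at \<open>i\<close> need only be compared below \<open>i\<close>.\<close>
  have slice: "\<exists>u\<in>N. \<forall>\<alpha>\<in>A. satisfies F \<alpha> \<and> graph \<alpha> i t \<longrightarrow>
      (\<exists>\<beta>\<in>A. satisfies F \<beta> \<and> graph \<beta> i t \<and> bounded u \<beta> \<and> below i \<beta> \<alpha>)" if t: "t \<in> N" for t
  proof -
    obtain G where G: "\<And>x. mem x G \<longleftrightarrow> x = pair_code i t \<or> mem x F"
      using fin_insert by blast
    have "\<not> mem (pair_code j w) G" if "j \<in> N" "w \<in> N" "j \<prec> i" for j w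
      using that F_i i t by (simp add: G pair_code_inject)
    moreover have "satisfies G \<alpha> \<longleftrightarrow> satisfies F \<alpha> \<and> graph \<alpha> i t" for \<alpha>
      using i t unfolding satisfies_def G by (metis pair_code_inject)
    ultimately show ?thesis using IH[of G] unfolding has_bounded_basis_def by simp
  qed
  \<comment> \<open>One bound for all values up to \<open>m\<close>.\<close>
  have "\<exists>u\<in>N. \<forall>t\<in>N. t \<preceq> m \<longrightarrow> (\<forall>\<alpha>\<in>A. satisfies F \<alpha> \<and> graph \<alpha> i t \<longrightarrow>
      (\<exists>\<beta>\<in>A. satisfies F \<beta> \<and> graph \<beta> i t \<and> bounded u \<beta> \<and> below i \<beta> \<alpha>))" if "m \<in> N" for m
    using that
  proof (induction m rule: nats_induct)
    case definable
    show ?case unfolding satisfies_def bounded_def below_def by (intro dpred_intros)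
  next
    case 0
    have "t = 0" if "t \<in> N" "t \<preceq> 0" for t using lt_0 that by blast
    then show ?case using slice[OF nats_0] by metis
  next
    case (Suc m)
    obtain u where u: "u \<in> N" "\<And>t \<alpha>. \<lbrakk>t \<in> N; t \<preceq> m; \<alpha> \<in> A; satisfies F \<alpha>; graph \<alpha> i t\<rbrakk> \<Longrightarrow>
        \<exists>\<beta>\<in>A. satisfies F \<beta> \<and> graph \<beta> i t \<and> bounded u \<beta> \<and> below i \<beta> \<alpha>"
      using Suc.IH by blast
    obtain u' where u': "u' \<in> N" "\<And>\<alpha>. \<lbrakk>\<alpha> \<in> A; satisfies F \<alpha>; graph \<alpha> i (m + 1)\<rbrakk> \<Longrightarrow>
        \<exists>\<beta>\<in>A. satisfies F \<beta> \<and> graph \<beta> i (m + 1) \<and> bounded u' \<beta> \<and> below i \<beta> \<alpha>"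
      using slice[OF nats_Suc[OF Suc.hyps]] by blast
    show ?case
    proof (intro bexI[of _ "u + u'"] ballI impI)
      fix t \<alpha> assume *: "t \<in> N" "t \<preceq> m + 1" "\<alpha> \<in> A" "satisfies F \<alpha> \<and> graph \<alpha> i t"
      show "\<exists>\<beta>\<in>A. satisfies F \<beta> \<and> graph \<beta> i t \<and> bounded (u + u') \<beta> \<and> below i \<beta> \<alpha>"
      proof (cases "t \<preceq> m")
        case True
        then show ?thesis
          using u(2)[of t \<alpha>] * bounded_mono[OF _ le_add_right[OF u'(1)]] by blast
      next
        case False
        then have "t = m + 1" using * by (simp add: le_Suc_iff)
        then show ?thesis
          using u'(2)[of \<alpha>] * bounded_mono[OF _ le_add_left[OF u(1)]] by blast
      qed
    qed (rule nats_add[OF u(1) u'(1)])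
  qed
  from this[OF u\<^sub>0(1)] obtain u where u: "u \<in> N"
    "\<And>t \<alpha>. \<lbrakk>t \<in> N; t \<preceq> u\<^sub>0; \<alpha> \<in> A; satisfies F \<alpha>; graph \<alpha> i t\<rbrakk> \<Longrightarrow>
      \<exists>\<beta>\<in>A. satisfies F \<beta> \<and> graph \<beta> i t \<and> bounded u \<beta> \<and> below i \<beta> \<alpha>" by blast
  have "\<exists>\<beta>\<in>A. satisfies F \<beta> \<and> bounded (u\<^sub>0 + u) \<beta> \<and> below (i + 1) \<beta> \<alpha>"
    if \<alpha>: "\<alpha> \<in> A" "satisfies F \<alpha>" for \<alpha>
  proof (cases "\<exists>t. graph \<alpha> i t \<and> t \<preceq> u\<^sub>0")
    case True
    then obtain t where t: "graph \<alpha> i t" "t \<preceq> u\<^sub>0" by blast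
    then obtain \<beta> where \<beta>: "\<beta> \<in> A" "satisfies F \<beta>" "graph \<beta> i t" "bounded u \<beta>" "below i \<beta> \<alpha>"
      using u(2)[OF graphD(3)[OF t(1)] t(2) \<alpha> t(1)] by blast
    have "below (i + 1) \<beta> \<alpha>"
    proof (rule below_Suc[OF \<beta>(5)])
      show "w \<preceq> w'" if "graph \<beta> i w" "graph \<alpha> i w'" for w w'
        using graph_unique[OF \<alpha>(1) t(1) that(2)] graph_unique[OF \<beta>(1,3) that(1)] by simp
    qed
    then show ?thesis using \<beta> bounded_mono[OF _ le_add_left[OF u\<^sub>0(1)]] by blast
  next
    case False
    obtain \<beta> where \<beta>: "\<beta> \<in> A" "satisfies F \<beta>" "bounded u\<^sub>0 \<beta>" "below i \<beta> \<alpha>"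
      using u\<^sub>0(2)[OF \<alpha>] by blast
    have "below (i + 1) \<beta> \<alpha>"
    proof (rule below_Suc[OF \<beta>(4)])
      fix w w' assume w: "graph \<beta> i w" "graph \<alpha> i w'"
      have "w \<preceq> u\<^sub>0" using \<beta>(3) graphD[OF w(1)] w(1) unfolding bounded_def by blast
      moreover have "u\<^sub>0 \<preceq> w'" using False w(2) le_total[OF u\<^sub>0(1) graphD(3)[OF w(2)]] by blast
      ultimately show "w \<preceq> w'" by (rule le_trans)
    qed
    then show ?thesis using \<beta> bounded_mono[OF _ le_add_right[OF u(1)]] by blast
  qed
  then show ?thesis unfolding has_bounded_basis_def using nats_add[OF u\<^sub>0(1) u(1)] by blast
qed

text \<open>
  For \<open>i = 0\<close> any two functions are comparable, so a single function is a basis, and it is bounded.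
\<close>

lemma bounded_basis_constrained:
  assumes "i \<in> N"
  shows "\<forall>F. (\<forall>j\<in>N. \<forall>w\<in>N. j \<prec> i \<longrightarrow> \<not> mem (pair_code j w) F) \<longrightarrow> has_bounded_basis i F"
  using assms
proof (induction i rule: nats_induct)
  case definable
  show ?case
    unfolding has_bounded_basis_def satisfies_def bounded_def below_def by (intro dpred_intros)
next
  case 0
  have "has_bounded_basis 0 F" for F
  proof (cases "\<exists>\<beta>\<in>A. satisfies F \<beta>")
    case True
    then obtain \<beta> where \<beta>: "\<beta> \<in> A" "satisfies F \<beta>" by blast
    moreover obtain u where "u \<in> N" "bounded u \<beta>" using bounded_ex[OF \<beta>(1)] by blast
    moreover have "below 0 \<beta> \<alpha>" for \<alpha> unfolding below_def using lt_0 by blast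
    ultimately show ?thesis unfolding has_bounded_basis_def by blast
  qed (use nats_0 in \<open>auto simp: has_bounded_basis_def\<close>)
  then show ?case by blast
next
  case (Suc i)
  show ?case
  proof (intro allI impI)
    fix F assume F: "\<forall>j\<in>N. \<forall>w\<in>N. j \<prec> i + 1 \<longrightarrow> \<not> mem (pair_code j w) F"
    show "has_bounded_basis (i + 1) F"
      by (rule bounded_basis_step) (use Suc F in blast)+
  qed
qed

lemma bounded_basis:
  "\<exists>u\<in>N. is_basis (hyp_funs_le mem n R) A {\<alpha> \<in> A. bounded u \<alpha>}"
proof -
  obtain F where F: "\<And>x. \<not> mem x F" using fin_empty by blast
  then have "has_bounded_basis n F" using bounded_basis_constrained[OF n] by blast
  then obtain u where u: "u \<in> N" "\<And>\<alpha>. \<alpha> \<in> A \<Longrightarrow> \<exists>\<beta>\<in>A. bounded u \<beta> \<and> below n \<beta> \<alpha>"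
    using F unfolding has_bounded_basis_def satisfies_def by blast
  have "hyp_funs_le mem n R \<beta> \<alpha>" if "\<alpha> \<in> A" "\<beta> \<in> A" "below n \<beta> \<alpha>" for \<alpha> \<beta>
    unfolding hyp_funs_le_def
  proof
    fix i assume i: "i \<in> seg mem n"
    then have "i \<in> N" "i \<prec> n" by (simp_all add: seg_def)
    moreover note graph_hyp_app[OF that(1) i] graph_hyp_app[OF that(2) i]
    ultimately show "hyp_app mem R \<beta> i \<preceq> hyp_app mem R \<alpha> i"
      using that(3) graphD(3) unfolding below_def by blast
  qed
  then have "is_basis (hyp_funs_le mem n R) A {\<alpha> \<in> A. bounded u \<alpha>}"
    using u(2) unfolding is_basis_def by blast
  then show ?thesis using u(1) by blast
qed

subsection \<open>Bounded functions form a hyperfinite set\<close>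

lemma definable_bounded: "eq_definable mem {\<alpha> \<in> A. bounded u \<alpha>}"
proof -
  have "dpred (\<lambda>v. map v [0..<length ss] \<in> A \<and> bounded u (map v [0..<length ss]))"
    unfolding bounded_def by (intro dpred_intros dpred_in A)
  then have "eq_definable mem {xs \<in> tuples (edom mem) ss. xs \<in> A \<and> bounded u xs}"
    by (rule definable_tuple_set)
  moreover have "{xs \<in> tuples (edom mem) ss. xs \<in> A \<and> bounded u xs} = {\<alpha> \<in> A. bounded u \<alpha>}"
    using A_tuples by blast
  ultimately show ?thesis by simp
qed

text \<open>
  The element \<open>G\<close> lists functions restricted below \<open>i\<close>: the value at \<open>l\<close> of the function with index \<open>j\<close>
  is the \<open>w\<close> such that the code of \<open>(j, (l, w))\<close> belongs to \<open>G\<close>. The list for \<open>i + 1\<close> has an entry for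
  each index \<open>j\<close> and each possible value \<open>v \<le> u\<close> at \<open>i\<close>, and \<open>pair_code j v\<close> is its index.
\<close>

lemma enumeration_step:
  assumes i: "i \<in> N" and u: "u \<in> N" and k: "k \<in> N"
    and G: "\<And>\<alpha>. \<lbrakk>\<alpha> \<in> A; bounded u \<alpha>\<rbrakk> \<Longrightarrow> \<exists>j\<in>N. j \<preceq> k \<and> (\<forall>l\<in>N. \<forall>w\<in>N. l \<in> seg mem n \<and> l \<prec> i \<longrightarrow>
          (mem (pair_code j (pair_code l w)) G \<longleftrightarrow> graph \<alpha> l w))"
  shows "\<exists>H. \<exists>k'\<in>N. \<forall>\<alpha>\<in>A. bounded u \<alpha> \<longrightarrow> (\<exists>j\<in>N. j \<preceq> k' \<and>
        (\<forall>l\<in>N. \<forall>w\<in>N. l \<in> seg mem n \<and> l \<prec> i + 1 \<longrightarrow>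
          (mem (pair_code j (pair_code l w)) H \<longleftrightarrow> graph \<alpha> l w)))"
proof (cases "i \<in> seg mem n")
  case False
  then have "l \<prec> i + 1 \<longleftrightarrow> l \<prec> i" if "l \<in> seg mem n" for l
    using that unfolding lt_Suc_iff by blast
  then show ?thesis using G k by (intro exI[of _ G] bexI[of _ k]) metis+
next
  case True
  \<comment> \<open>The bounds on \<open>j\<close>, \<open>v\<close>, \<open>l\<close>, \<open>w\<close> keep the codes in an initial segment, so that they form an element of the second sort.\<close>
  let ?Q = "\<lambda>x. \<exists>j\<in>N. \<exists>v\<in>N. \<exists>l\<in>N. \<exists>w\<in>N. (j \<preceq> k \<and> v \<preceq> u \<and> l \<preceq> i \<and> w \<preceq> u) \<and>
      x = pair_code (pair_code j v) (pair_code l w) \<and>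
      (l \<prec> i \<and> mem (pair_code j (pair_code l w)) G \<or> l = i \<and> w = v)"
  have "\<exists>H. \<forall>x. mem x H \<longleftrightarrow> ?Q x"
  proof (rule bounded_comprehension)
    show "dpred (\<lambda>v. ?Q (un_fld (v 0)))" by (intro dpred_arith_intros)
    show "pair_code (pair_code k u) (pair_code i u) \<in> N"
      using i u k by (intro pair_code_nats)
    show "x \<in> N \<and> x \<preceq> pair_code (pair_code k u) (pair_code i u)" if "?Q x" for x
      using that by (auto intro!: pair_code_nats pair_code_mono)
  qed
  then obtain H where H: "\<And>x. mem x H \<longleftrightarrow> ?Q x" by blast
  have H': "mem (pair_code (pair_code j v) (pair_code l w)) H \<longleftrightarrow>
      l \<prec> i \<and> mem (pair_code j (pair_code l w)) G \<and> w \<preceq> u \<or> l = i \<and> w = v"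
    if "j \<in> N" "v \<in> N" "l \<in> N" "w \<in> N" "j \<preceq> k" "v \<preceq> u" for j v l w
  proof -
    have "pair_code (pair_code j v) (pair_code l w) = pair_code (pair_code j' v') (pair_code l' w')
        \<longleftrightarrow> j = j' \<and> v = v' \<and> l = l' \<and> w = w'"
      if "j' \<in> N" "v' \<in> N" "l' \<in> N" "w' \<in> N" for j' v' l' w'
      using that \<open>j \<in> N\<close> \<open>v \<in> N\<close> \<open>l \<in> N\<close> \<open>w \<in> N\<close>
      by (simp add: pair_code_inject pair_code_nats)
    then have "?Q (pair_code (pair_code j v) (pair_code l w)) \<longleftrightarrow>
        (j \<preceq> k \<and> v \<preceq> u \<and> l \<preceq> i \<and> w \<preceq> u) \<and>
        (l \<prec> i \<and> mem (pair_code j (pair_code l w)) G \<or> l = i \<and> w = v)"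
      using \<open>j \<in> N\<close> \<open>v \<in> N\<close> \<open>l \<in> N\<close> \<open>w \<in> N\<close> by (auto simp del: split_paired_Ex)
    then show ?thesis unfolding H using that by auto
  qed
  have "\<exists>j\<in>N. j \<preceq> pair_code k u \<and> (\<forall>l\<in>N. \<forall>w\<in>N. l \<in> seg mem n \<and> l \<prec> i + 1 \<longrightarrow>
          (mem (pair_code j (pair_code l w)) H \<longleftrightarrow> graph \<alpha> l w))"
    if \<alpha>: "\<alpha> \<in> A" "bounded u \<alpha>" for \<alpha>
  proof -
    obtain j where j: "j \<in> N" "j \<preceq> k" and Gj: "\<And>l w. \<lbrakk>l \<in> N; w \<in> N; l \<in> seg mem n; l \<prec> i\<rbrakk> \<Longrightarrow>
        mem (pair_code j (pair_code l w)) G \<longleftrightarrow> graph \<alpha> l w"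
      using G[OF \<alpha>] by blast
    obtain v where v: "graph \<alpha> i v" using graph_ex1[OF \<alpha>(1) True] by blast
    have le_u: "w \<preceq> u" if "graph \<alpha> l w" for l w
      using \<alpha>(2) graphD[OF that] that unfolding bounded_def by blast
    have "mem (pair_code (pair_code j v) (pair_code l w)) H \<longleftrightarrow> graph \<alpha> l w"
      if l: "l \<in> N" "w \<in> N" "l \<in> seg mem n" "l \<prec> i + 1" for l w
      unfolding H'[OF j(1) graphD(3)[OF v] l(1,2) j(2) le_u[OF v]]
    proof (cases "l = i")
      case True
      then show "l \<prec> i \<and> mem (pair_code j (pair_code l w)) G \<and> w \<preceq> u \<or> l = i \<and> w = v
          \<longleftrightarrow> graph \<alpha> l w"
        using graph_unique[OF \<alpha>(1) v] v by blast
    next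
      case False
      then have "l \<prec> i" using l(4) unfolding lt_Suc_iff by blast
      then show "l \<prec> i \<and> mem (pair_code j (pair_code l w)) G \<and> w \<preceq> u \<or> l = i \<and> w = v
          \<longleftrightarrow> graph \<alpha> l w"
        using Gj[OF l(1-3)] le_u[of l w] by blast
    qed
    moreover have "pair_code j v \<in> N" "pair_code j v \<preceq> pair_code k u"
      using j graphD(3)[OF v] le_u[OF v] by (auto intro: pair_code_nats pair_code_mono)
    ultimately show ?thesis by blast
  qed
  then show ?thesis using pair_code_nats[OF k u] by blast
qed

text \<open>
  All functions bounded by \<open>u\<close> are listed, possibly more than once and along with others.
\<close>

lemma enumeration:
  assumes "i \<in> N" and u: "u \<in> N"
  shows "\<exists>G. \<exists>k\<in>N. \<forall>\<alpha>\<in>A. bounded u \<alpha> \<longrightarrow> (\<exists>j\<in>N. j \<preceq> k \<and>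
        (\<forall>l\<in>N. \<forall>w\<in>N. l \<in> seg mem n \<and> l \<prec> i \<longrightarrow>
          (mem (pair_code j (pair_code l w)) G \<longleftrightarrow> graph \<alpha> l w)))"
  using assms(1)
proof (induction i rule: nats_induct)
  case definable
  show ?case unfolding bounded_def by (intro dpred_intros)
next
  case 0
  show ?case using lt_0 nats_0 le_refl by blast
next
  case (Suc i)
  then obtain G k where "k \<in> N" "\<And>\<alpha>. \<lbrakk>\<alpha> \<in> A; bounded u \<alpha>\<rbrakk> \<Longrightarrow>
      \<exists>j\<in>N. j \<preceq> k \<and> (\<forall>l\<in>N. \<forall>w\<in>N. l \<in> seg mem n \<and> l \<prec> i \<longrightarrow>
          (mem (pair_code j (pair_code l w)) G \<longleftrightarrow> graph \<alpha> l w))" by blast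
  then show ?case by (rule enumeration_step[OF Suc.hyps u])
qed

text \<open>
  A function may have several indices in the enumeration; the least one is a definable choice. It
  determines the function, because the enumeration records all values.
\<close>

lemma hyperfinite_bounded:
  assumes u: "u \<in> N"
  shows "hyperfinite mem {\<alpha> \<in> A. bounded u \<alpha>}"
proof -
  let ?B = "{\<alpha> \<in> A. bounded u \<alpha>}"
  obtain G k where k: "k \<in> N" and enum: "\<And>\<alpha>. \<alpha> \<in> ?B \<Longrightarrow> \<exists>j\<in>N. j \<preceq> k \<and>
        (\<forall>l\<in>N. \<forall>w\<in>N. l \<in> seg mem n \<and> l \<prec> n \<longrightarrow>
          (mem (pair_code j (pair_code l w)) G \<longleftrightarrow> graph \<alpha> l w))"
    using enumeration[OF n u] by blast
  define idx where "idx \<alpha> j \<longleftrightarrow> (\<forall>l\<in>N. \<forall>w\<in>N. l \<in> seg mem n \<longrightarrow>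
      (mem (pair_code j (pair_code l w)) G \<longleftrightarrow> graph \<alpha> l w))" for \<alpha> j
  have idx_ex: "\<exists>j\<in>N. j \<preceq> k \<and> idx \<alpha> j" if "\<alpha> \<in> ?B" for \<alpha>
    using enum[OF that] unfolding idx_def seg_def by blast
  define least where "least \<alpha> j \<longleftrightarrow> j \<in> N \<and> idx \<alpha> j \<and> (\<forall>j'\<in>N. idx \<alpha> j' \<longrightarrow> j \<preceq> j')" for \<alpha> j
  have least_ex: "\<exists>j. least \<alpha> j" if \<alpha>: "\<alpha> \<in> ?B" for \<alpha>
  proof -
    have "\<alpha> \<in> A" using \<alpha> by blast
    obtain j where "j \<in> N" "idx \<alpha> j" using idx_ex[OF \<alpha>] by blast
    have "\<exists>j\<in>N. idx \<alpha> j \<and> (\<forall>j'\<in>N. idx \<alpha> j' \<longrightarrow> j \<preceq> j')"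
    proof (rule nats_least)
      show "dpred (\<lambda>v. idx \<alpha> (un_fld (v 0)))"
        unfolding idx_def by (intro dpred_arith_intros dpred_graph dtuple_const \<open>\<alpha> \<in> A\<close>)
    qed fact+
    then show ?thesis unfolding least_def by blast
  qed
  have least_unique: "j = j'" if "least \<alpha> j" "least \<alpha> j'" for \<alpha> j j'
    using that unfolding least_def by (intro le_antisym) blast+
  define c where "c \<alpha> = (THE j. least \<alpha> j)" for \<alpha>
  have c: "least \<alpha> (c \<alpha>)" if "\<alpha> \<in> ?B" for \<alpha>
    unfolding c_def by (rule theI') (use least_ex[OF that] least_unique in blast)
  obtain F where F: "\<And>x. mem x F \<longleftrightarrow> x \<in> N \<and> x \<preceq> k" using fin_segment[OF k] by blast
  show ?thesis
  proof (rule hyperfinite_if_coded[where Q = least and c = c and F\<^sub>0 = F and ss = ss])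
    show "eq_definable mem ?B" by (rule definable_bounded)
    show "?B \<subseteq> tuples (edom mem) ss" using A_tuples by blast
    show "dpred (\<lambda>v. least (t v) (s v))" if t: "dtuple t" and s: "dfld s" for t s
    proof -
      have dpred_idx: "dpred (\<lambda>v. idx (t v) (s v))" if t: "dtuple t" and s: "dfld s" for t s
      proof -
        have "dtuple (\<lambda>v. t (\<lambda>i. v (Suc (Suc (Suc i)))))"
          by (rule atomic_tuple_subst[OF t]) (rule atomic_var)
        then have "dpred (\<lambda>v. idx (t (\<lambda>i. v (Suc i))) (un_fld (v 0)))"
          unfolding idx_def by (intro dpred_arith_intros dpred_graph)
        then show ?thesis
          using dpred_plug_fld[where Q = "\<lambda>v e. idx (t v) (un_fld e)", OF s] by simp
      qed
      have "dtuple (\<lambda>v. t (\<lambda>i. v (Suc (Suc i))))" "dtuple (\<lambda>v. t (\<lambda>i. v (Suc i)))"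
        by (rule atomic_tuple_subst[OF t], rule atomic_var)+
      then have "dpred (\<lambda>v. least (t (\<lambda>i. v (Suc i))) (un_fld (v 0)))"
        unfolding least_def by (intro dpred_arith_intros dpred_idx)
      then show ?thesis
        using dpred_plug_fld[where Q = "\<lambda>v e. least (t v) (un_fld e)", OF s] by simp
    qed
    show "least \<alpha> x \<longleftrightarrow> x = c \<alpha>" if "\<alpha> \<in> ?B" for \<alpha> x
      using c[OF that] least_unique by blast
    show "inj_on c ?B"
    proof (rule inj_onI)
      fix \<alpha> \<beta> assume *: "\<alpha> \<in> ?B" "\<beta> \<in> ?B" and eq: "c \<alpha> = c \<beta>"
      have idx: "idx \<alpha> (c \<alpha>)" "idx \<beta> (c \<alpha>)"
        using c[OF *(1)] c[OF *(2)] unfolding least_def eq by blast+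
      show "\<alpha> = \<beta>"
      proof (rule graph_ext)
        show "graph \<alpha> i w \<longleftrightarrow> graph \<beta> i w" for i w
          using idx graphD[of \<alpha> i w] graphD[of \<beta> i w] unfolding idx_def by blast
      qed (use * in blast)+
    qed
    show "mem (c \<alpha>) F" if \<alpha>: "\<alpha> \<in> ?B" for \<alpha>
    proof -
      obtain j where j: "j \<in> N" "j \<preceq> k" "idx \<alpha> j" using idx_ex[OF \<alpha>] by blast
      then have "c \<alpha> \<in> N" "c \<alpha> \<preceq> j" using c[OF \<alpha>] unfolding least_def by blast+
      then show ?thesis unfolding F using le_trans[OF _ j(2)] by blast
    qed
  qed
qed

end

section \<open>Hyperfinite bases\<close>

theorem lemma9p6:
  fixes mem :: "'a::field \<Rightarrow> 'f \<Rightarrow> bool"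
    and n :: 'a
    and P A :: "('a, 'f) eel list set"
    and R :: "(('a, 'f) eel list \<times> ('a, 'f) eel list) set"
  assumes "finite_power_field mem"
    and "definable_char_zero mem"
    and "n \<in> nats mem"
    and "finite_power_set mem (seg_times_nats mem n) P R"
    and "eq_definable mem A"
    and "A \<subseteq> hyp_funs mem n P R"
  shows "\<exists>B. hyperfinite mem B \<and> is_basis (hyp_funs_le mem n R) A B"
proof -
  obtain ss where "A \<subseteq> tuples (edom mem) ss"
    using assms(5) unfolding definable_def by blast
  then interpret definable_hyp_funs mem n P A R ss
    by unfold_locales (rule assms)+
  show ?thesis using bounded_basis hyperfinite_bounded by blast
qed

end
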